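(* Let $G$ be a finite group, $R$ a commutative ring, $\alpha=(D_g,\alpha_g)_{g\in G}$ a unital partial action of $G$ on $R$ with $D_g=R1_g$, and suppose that $R\supseteq R^\alpha$ is an $\alpha$-partial Galois extension. Let $A$ be an Azumaya $R^\alpha$-algebra containing $R$ as a maximal commutative subalgebra. For $g\in G$ let $$C_g=\{a\in 1_{g^{-1}}A:\ \alpha_{g^{-1}}(r1_g)a=ar\ \ \forall r\in R\},$$ and let $f_A\in Z^1(G,\alpha^*,\mathbf{PicS}_R(R))$ be the cocycle $f_A(g)=[C_g]$ (so that $\phi_5(\llbracket A\rrbracket)=\mathrm{cls}(f_A)$ in $H^1(G,\alpha^*,\mathbf{PicS}_R(R))$). Let $\Gamma=f_A\Theta$ be the unital partial representation with $\Gamma_g=C_g$ as sets, with $R$-actions $r\star a=ar$ and $a\star r=ra$ ($r\in R$, $a\in \Gamma_g$), endowed with the factor set $\Gamma_g\otimes_R\Gamma_h\ni u_g\otimes u_h\mapsto u_hu_g\in 1_g\star\Gamma_{gh}$ (product in $A$). Then the partial generalized crossed product $\Delta(\Gamma)=\bigoplus_{g\in G}\Gamma_g$, with multiplication $u_g\circ u_h=u_hu_g$, satisfies $\Delta(\Gamma)\simeq A^{\mathrm{op}}$ as $R^\alpha$-algebras.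
   Context: All rings are associative with unity. A unital partial action $\alpha=(D_g,\alpha_g)_{g\in G}$ of $G$ on a commutative ring $R$ consists of ideals $D_g=R1_g$ generated by idempotents $1_g$ and ring isomorphisms $\alpha_g:D_{g^{-1}}\to D_g$ such that $D_1=R$, $\alpha_1=\mathrm{id}$, $\alpha_h^{-1}(D_h\cap D_{g^{-1}})\subseteq D_{(gh)^{-1}}$ and $\alpha_g\circ\alpha_h=\alpha_{gh}$ on $\alpha_h^{-1}(D_h\cap D_{g^{-1}})$. $R^\alpha=\{r\in R:\alpha_g(r1_{g^{-1}})=r1_g\ \forall g\}$. $R\supseteq R^\alpha$ is an $\alpha$-partial Galois extension if there are $m\in\mathbb N$ and $x_i,y_i\in R$, $1\le i\le m$, with $\sum_i x_i\alpha_g(y_i1_{g^{-1}})=\delta_{1,g}$ for all $g\in G$ (equal to $1_R$ if $g=1$ and $0$ otherwise). An Azumaya $k$-algebra ($k$ commutative) is a $k$-algebra $A$ that is separable over $k$ (i.e. projective over $A\otimes_kA^{\mathrm{op}}$) with center $k1_A$; $\llbracket A\rrbracket$ is its class in the Brauer group $\mathcal B(k)$. $\mathcal B(R/R^\alpha)$ is the kernel of $\mathcal B(R^\alpha)\to\mathcal B(R)$, $\llbracket A\rrbracket\mapsto\llbracket A\otimes_{R^\alpha}R\rrbracket$; each class in it has a representative containing $R$ as a maximal commutative subalgebra, and any Azumaya $R^\alpha$-algebra containing $R$ as a maximal commutative subalgebra has class in $\mathcal B(R/R^\alpha)$. An $R$-bimodule $P$ is partially invertible if it is finitely generated projective as a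 left and as a right $R$-module and the maps $R\to \mathrm{End}(P_R)$, $r\mapsto(p\mapsto rp)$, and $R\to\mathrm{End}({}_RP)$, $r\mapsto (p\mapsto pr)$, are surjective. $\mathbf{PicS}(R)$ is the monoid of isomorphism classes of partially invertible $R$-bimodules under $\otimes_R$; $\mathbf{PicS}_k(R)$ consists of the classes of those central over the subring $k\subseteq R$. $\Theta:G\to\mathbf{PicS}_{R^\alpha}(R)$ is the unital partial representation $g\mapsto[(D_g)_{g^{-1}}]$, where $(D_g)_{g^{-1}}=D_g$ as a set with $r*d=rd$, $d*r=d\alpha_g(r1_{g^{-1}})$; $f_A\Theta$ is the map $g\mapsto f_A(g)\Theta(g)$. The partial action $\alpha^*=(\mathcal X_g,\alpha_g^* )$ of $G$ on $\mathbf{PicS}_R(R)$: $\mathcal X_g=\mathbf{PicS}_R(R)[D_g]$, $\alpha_g^*([P])=[P_g]$ with $P_g=P$ as a set and $r\bullet p=\alpha_{g^{-1}}(r1_g)p$. $Z^1(G,\alpha^*,\mathbf{PicS}_R(R))$ is the group of functions $f:G\to\mathbf{PicS}_R(R)$ with $f(g)$ invertible in the monoid $\mathcal X_g$ (identity $[D_g]$) and $\alpha_g^*(f(h)[D_{g^{-1}}])f(g)=f(gh)[D_g]$; $B^1$ is the subgroup of the functions $g\mapsto\alpha_g^*([P][D_{g^{-1}}])[P]^{-1}$ with $[P]\in\mathbf{Pic}_R(R)$ (invertible elements of $\mathbf{PicS}_R(R)$), and $H^1=Z^1/B^1$. $C_g$ is a central $R$-bimodule via $r\cdot a=\alpha_{g^{-1}}(r1_g)a=ar$.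 It is known from earlier work that $[C_g]\in\mathbf{PicS}_R(R)$, that $f_A$ is a cocycle, that $\phi_5:\mathcal B(R/R^\alpha)\to H^1(G,\alpha^*,\mathbf{PicS}_R(R))$, $\llbracket A\rrbracket\mapsto\mathrm{cls}(f_A)$ (for $A$ containing $R$ as a maximal commutative subalgebra), is a well-defined group homomorphism, and that $\Gamma$ above is a unital partial representation ($[\Gamma_g]=f_A(g)\Theta(g)$) for which the displayed maps form a factor set, i.e. are $R$-bimodule isomorphisms satisfying the associativity condition, making $\Delta(\Gamma)$ an associative unital ring. *)

theory Defs
  imports "HOL-Algebra.Free_Abelian_Groups" "HOL-Algebra.QuotRing" "HOL-Algebra.Subrings" "HOL-Algebra.Module"
begin

section \<open>Unital partial actions\<close>

text \<open>The idempotent \<open>1\<^sub>g\<close> is \<^term>\<open>e g\<close> and \<open>D\<^sub>g = R1\<^sub>g\<close> is the principal ideal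
  it generates, so that \<open>D\<^sub>g\<close> is a ring with unity \<open>1\<^sub>g\<close>.\<close>

definition pdom :: "('a, 'm) ring_scheme \<Rightarrow> ('g \<Rightarrow> 'a) \<Rightarrow> 'g \<Rightarrow> 'a set"
  where "pdom R e g = PIdl\<^bsub>R\<^esub> (e g)"

definition pdom_ring :: "('a, 'm) ring_scheme \<Rightarrow> ('g \<Rightarrow> 'a) \<Rightarrow> 'g \<Rightarrow> ('a, 'm) ring_scheme"
  where "pdom_ring R e g = R\<lparr>carrier := pdom R e g, one := e g\<rparr>"

locale unital_partial_action = G?: group G + R?: cring R
  for G :: "('g, 'n) monoid_scheme" (structure) and R :: "('a, 'm) ring_scheme" (structure) +
  fixes e :: "'g \<Rightarrow> 'a" and \<alpha> :: "'g \<Rightarrow> 'a \<Rightarrow> 'a"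
  assumes idem_closed: "g \<in> carrier G \<Longrightarrow> e g \<in> carrier R"
    and idem: "g \<in> carrier G \<Longrightarrow> e g \<otimes>\<^bsub>R\<^esub> e g = e g"
    and iso: "g \<in> carrier G \<Longrightarrow> \<alpha> g \<in> ring_iso (pdom_ring R e (inv\<^bsub>G\<^esub> g)) (pdom_ring R e g)"
    and dom_one: "pdom R e \<one>\<^bsub>G\<^esub> = carrier R"
    and act_one: "r \<in> carrier R \<Longrightarrow> \<alpha> \<one>\<^bsub>G\<^esub> r = r"
    and act_dom: "\<lbrakk>g \<in> carrier G; h \<in> carrier G; x \<in> pdom R e (inv\<^bsub>G\<^esub> h);
        \<alpha> h x \<in> pdom R e h \<inter> pdom R e (inv\<^bsub>G\<^esub> g)\<rbrakk> \<Longrightarrow> x \<in> pdom R e (inv\<^bsub>G\<^esub> (g \<otimes>\<^bsub>G\<^esub> h))"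
    and act_mult: "\<lbrakk>g \<in> carrier G; h \<in> carrier G; x \<in> pdom R e (inv\<^bsub>G\<^esub> h);
        \<alpha> h x \<in> pdom R e h \<inter> pdom R e (inv\<^bsub>G\<^esub> g)\<rbrakk> \<Longrightarrow> \<alpha> g (\<alpha> h x) = \<alpha> (g \<otimes>\<^bsub>G\<^esub> h) x"

definition invariants ::
  "('g, 'n) monoid_scheme \<Rightarrow> ('a, 'm) ring_scheme \<Rightarrow> ('g \<Rightarrow> 'a) \<Rightarrow> ('g \<Rightarrow> 'a \<Rightarrow> 'a) \<Rightarrow> ('a, 'm) ring_scheme"
  where "invariants G R e \<alpha> = R\<lparr>carrier := {r \<in> carrier R. \<forall>g \<in> carrier G.
           \<alpha> g (r \<otimes>\<^bsub>R\<^esub> e (inv\<^bsub>G\<^esub> g)) = r \<otimes>\<^bsub>R\<^esub> e g}\<rparr>"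

definition partial_galois_extension ::
  "('g, 'n) monoid_scheme \<Rightarrow> ('a, 'm) ring_scheme \<Rightarrow> ('g \<Rightarrow> 'a) \<Rightarrow> ('g \<Rightarrow> 'a \<Rightarrow> 'a) \<Rightarrow> bool"
  where "partial_galois_extension G R e \<alpha> \<longleftrightarrow>
    (\<exists>(m::nat) x y. x \<in> {1..m} \<rightarrow> carrier R \<and> y \<in> {1..m} \<rightarrow> carrier R \<and>
      (\<forall>g \<in> carrier G. (\<Oplus>\<^bsub>R\<^esub>i\<in>{1..m}. x i \<otimes>\<^bsub>R\<^esub> \<alpha> g (y i \<otimes>\<^bsub>R\<^esub> e (inv\<^bsub>G\<^esub> g)))
         = (if g = \<one>\<^bsub>G\<^esub> then \<one>\<^bsub>R\<^esub> else \<zero>\<^bsub>R\<^esub>)))"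

section \<open>Algebras over a commutative ring\<close>

text \<open>The library locales \<^locale>\<open>module\<close> and \<^locale>\<open>algebra\<close> require a commutative base ring
  and a commutative algebra, respectively.\<close>

locale k_algebra = module k A + ring A
  for k :: "('k, 'm) ring_scheme" and A :: "('k, 'a, 'n) module_scheme" +
  assumes smult_mult_left: "\<lbrakk>s \<in> carrier k; x \<in> carrier A; y \<in> carrier A\<rbrakk>
        \<Longrightarrow> (s \<odot>\<^bsub>A\<^esub> x) \<otimes>\<^bsub>A\<^esub> y = s \<odot>\<^bsub>A\<^esub> (x \<otimes>\<^bsub>A\<^esub> y)"
    and smult_mult_right: "\<lbrakk>s \<in> carrier k; x \<in> carrier A; y \<in> carrier A\<rbrakk>
        \<Longrightarrow> x \<otimes>\<^bsub>A\<^esub> (s \<odot>\<^bsub>A\<^esub> y) = s \<odot>\<^bsub>A\<^esub> (x \<otimes>\<^bsub>A\<^esub> y)"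

definition opposite :: "('k, 'a) module \<Rightarrow> ('k, 'a) module"
  where "opposite A = A\<lparr>mult := \<lambda>x y. y \<otimes>\<^bsub>A\<^esub> x\<rparr>"

definition algebra_isomorphic ::
  "('k, 'm) ring_scheme \<Rightarrow> ('k, 'a) module \<Rightarrow> ('k, 'b) module \<Rightarrow> bool"
  where "algebra_isomorphic k A B \<longleftrightarrow> k_algebra k A \<and> k_algebra k B \<and>
    (\<exists>\<phi> \<in> ring_iso A B. \<forall>s \<in> carrier k. \<forall>x \<in> carrier A. \<phi> (s \<odot>\<^bsub>A\<^esub> x) = s \<odot>\<^bsub>B\<^esub> \<phi> x)"

definition commutative_subalgebra :: "('k, 'm) ring_scheme \<Rightarrow> 'a set \<Rightarrow> ('k, 'a) module \<Rightarrow> bool"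
  where "commutative_subalgebra k S A \<longleftrightarrow> subcring S A \<and>
    (\<forall>s \<in> carrier k. \<forall>x \<in> S. s \<odot>\<^bsub>A\<^esub> x \<in> S)"

definition maximal_commutative_subalgebra :: "('k, 'm) ring_scheme \<Rightarrow> 'a set \<Rightarrow> ('k, 'a) module \<Rightarrow> bool"
  where "maximal_commutative_subalgebra k S A \<longleftrightarrow> commutative_subalgebra k S A \<and>
    (\<forall>T. commutative_subalgebra k T A \<and> S \<subseteq> T \<longrightarrow> T = S)"

text \<open>\<^term>\<open>A\<close> contains the extension \<^term>\<open>R\<close> of \<^term>\<open>k\<close> as a subalgebra: \<^term>\<open>R\<close> is a
  subset of \<^term>\<open>A\<close>, the ring operations of \<^term>\<open>R\<close> are those of \<^term>\<open>A\<close>, and \<^term>\<open>k\<close>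
  acts on \<^term>\<open>R\<close> inside \<^term>\<open>A\<close> by multiplication.\<close>

definition contains_extension ::
  "('a, 'm) ring_scheme \<Rightarrow> ('a, 'm) ring_scheme \<Rightarrow> ('a, 'a) module \<Rightarrow> bool"
  where "contains_extension k R A \<longleftrightarrow> carrier R \<subseteq> carrier A \<and> (\<lambda>x. x) \<in> ring_hom R A \<and>
    (\<forall>s \<in> carrier k. \<forall>r \<in> carrier R. s \<odot>\<^bsub>A\<^esub> r = s \<otimes>\<^bsub>R\<^esub> r)"

section \<open>Bimodules and tensor products\<close>

text \<open>As for \<^typ>\<open>('r, 'a) module\<close>, the \<^const>\<open>mult\<close> and \<^const>\<open>one\<close> fields play no role in a
  bimodule.\<close>

record ('r, 'a) bimodule = "('r, 'a) module" +
  rsmult :: "['a, 'r] \<Rightarrow> 'a"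

definition bimodule_isomorphic ::
  "('r, 'm) ring_scheme \<Rightarrow> ('r, 'a) bimodule \<Rightarrow> ('r, 'b) bimodule \<Rightarrow> bool"
  where "bimodule_isomorphic R M N \<longleftrightarrow>
    (\<exists>\<phi>. bij_betw \<phi> (carrier M) (carrier N) \<and>
      (\<forall>x \<in> carrier M. \<forall>y \<in> carrier M. \<phi> (x \<oplus>\<^bsub>M\<^esub> y) = \<phi> x \<oplus>\<^bsub>N\<^esub> \<phi> y) \<and>
      (\<forall>r \<in> carrier R. \<forall>x \<in> carrier M. \<phi> (r \<odot>\<^bsub>M\<^esub> x) = r \<odot>\<^bsub>N\<^esub> \<phi> x) \<and>
      (\<forall>r \<in> carrier R. \<forall>x \<in> carrier M. \<phi> (rsmult M x r) = rsmult N (\<phi> x) r))"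

text \<open>\<open>M \<otimes>\<^sub>R N\<close> is the free abelian group on \<open>M \<times> N\<close> modulo the subgroup generated by the
  usual relations; it inherits the left action of \<open>M\<close> and the right action of \<open>N\<close>.\<close>

definition tensor_relations ::
  "('r, 'm) ring_scheme \<Rightarrow> ('r, 'a) bimodule \<Rightarrow> ('r, 'b) bimodule \<Rightarrow> ('a \<times> 'b \<Rightarrow>\<^sub>0 int) set"
  where "tensor_relations R M N =
      {frag_of (x \<oplus>\<^bsub>M\<^esub> x', y) - frag_of (x, y) - frag_of (x', y) | x x' y.
         x \<in> carrier M \<and> x' \<in> carrier M \<and> y \<in> carrier N}
    \<union> {frag_of (x, y \<oplus>\<^bsub>N\<^esub> y') - frag_of (x, y) - frag_of (x, y') | x y y'.
         x \<in> carrier M \<and> y \<in> carrier N \<and> y' \<in> carrier N}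
    \<union> {frag_of (rsmult M x r, y) - frag_of (x, r \<odot>\<^bsub>N\<^esub> y) | x r y.
         x \<in> carrier M \<and> r \<in> carrier R \<and> y \<in> carrier N}"

definition tensor_kernel ::
  "('r, 'm) ring_scheme \<Rightarrow> ('r, 'a) bimodule \<Rightarrow> ('r, 'b) bimodule \<Rightarrow> ('a \<times> 'b \<Rightarrow>\<^sub>0 int) set"
  where "tensor_kernel R M N =
    generate (free_Abelian_group (carrier M \<times> carrier N)) (tensor_relations R M N)"

definition tensor_class ::
  "('r, 'm) ring_scheme \<Rightarrow> ('r, 'a) bimodule \<Rightarrow> ('r, 'b) bimodule \<Rightarrow>
    ('a \<times> 'b \<Rightarrow>\<^sub>0 int) \<Rightarrow> ('a \<times> 'b \<Rightarrow>\<^sub>0 int) set"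
  where "tensor_class R M N t =
    tensor_kernel R M N #>\<^bsub>free_Abelian_group (carrier M \<times> carrier N)\<^esub> t"

definition pure_tensor ::
  "('r, 'm) ring_scheme \<Rightarrow> ('r, 'a) bimodule \<Rightarrow> ('r, 'b) bimodule \<Rightarrow> 'a \<Rightarrow> 'b \<Rightarrow> ('a \<times> 'b \<Rightarrow>\<^sub>0 int) set"
  where "pure_tensor R M N x y = tensor_class R M N (frag_of (x, y))"

definition tensor_group ::
  "('r, 'm) ring_scheme \<Rightarrow> ('r, 'a) bimodule \<Rightarrow> ('r, 'b) bimodule \<Rightarrow> ('a \<times> 'b \<Rightarrow>\<^sub>0 int) set monoid"
  where "tensor_group R M N = free_Abelian_group (carrier M \<times> carrier N) Mod tensor_kernel R M N"

definition tensor_product ::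
  "('r, 'm) ring_scheme \<Rightarrow> ('r, 'a) bimodule \<Rightarrow> ('r, 'b) bimodule \<Rightarrow> ('r, ('a \<times> 'b \<Rightarrow>\<^sub>0 int) set) bimodule"
  where "tensor_product R M N =
    \<lparr>carrier = carrier (tensor_group R M N), mult = undefined, one = undefined,
     zero = one (tensor_group R M N), add = mult (tensor_group R M N),
     smult = (\<lambda>r w. \<Union>t\<in>w. tensor_class R M N (frag_extend (\<lambda>(x, y). frag_of (r \<odot>\<^bsub>M\<^esub> x, y)) t)),
     rsmult = (\<lambda>w r. \<Union>t\<in>w. tensor_class R M N (frag_extend (\<lambda>(x, y). frag_of (x, rsmult N y r)) t))\<rparr>"

text \<open>The additive map \<open>M \<otimes>\<^sub>R N \<rightarrow> P\<close>, \<open>x \<otimes> y \<mapsto> b x y\<close>, induced by a balanced map \<open>b\<close>: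
  every representative of a class has the same value.\<close>

definition frag_eval :: "('c, 'm) ring_scheme \<Rightarrow> ('a \<Rightarrow> 'c) \<Rightarrow> ('a \<Rightarrow>\<^sub>0 int) \<Rightarrow> 'c"
  where "frag_eval P f t = (\<Oplus>\<^bsub>P\<^esub>p\<in>Poly_Mapping.keys t. [Poly_Mapping.lookup t p] \<cdot>\<^bsub>P\<^esub> f p)"

definition tensor_lift :: "('c, 'm) ring_scheme \<Rightarrow> ('a \<Rightarrow> 'b \<Rightarrow> 'c) \<Rightarrow> ('a \<times> 'b \<Rightarrow>\<^sub>0 int) set \<Rightarrow> 'c"
  where "tensor_lift P b w = the_elem (frag_eval P (\<lambda>(x, y). b x y) ` w)"

section \<open>Azumaya algebras\<close>

locale left_module = S?: ring S + M?: abelian_group M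
  for S :: "('s, 'm) ring_scheme" (structure) and M :: "('s, 'a, 'n) module_scheme" (structure) +
  assumes left_smult_closed: "\<lbrakk>a \<in> carrier S; x \<in> carrier M\<rbrakk> \<Longrightarrow> a \<odot>\<^bsub>M\<^esub> x \<in> carrier M"
    and left_smult_l_distr: "\<lbrakk>a \<in> carrier S; b \<in> carrier S; x \<in> carrier M\<rbrakk>
        \<Longrightarrow> (a \<oplus>\<^bsub>S\<^esub> b) \<odot>\<^bsub>M\<^esub> x = a \<odot>\<^bsub>M\<^esub> x \<oplus>\<^bsub>M\<^esub> b \<odot>\<^bsub>M\<^esub> x"
    and left_smult_r_distr: "\<lbrakk>a \<in> carrier S; x \<in> carrier M; y \<in> carrier M\<rbrakk>
        \<Longrightarrow> a \<odot>\<^bsub>M\<^esub> (x \<oplus>\<^bsub>M\<^esub> y) = a \<odot>\<^bsub>M\<^esub> x \<oplus>\<^bsub>M\<^esub> a \<odot>\<^bsub>M\<^esub> y"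
    and left_smult_assoc: "\<lbrakk>a \<in> carrier S; b \<in> carrier S; x \<in> carrier M\<rbrakk>
        \<Longrightarrow> (a \<otimes>\<^bsub>S\<^esub> b) \<odot>\<^bsub>M\<^esub> x = a \<odot>\<^bsub>M\<^esub> (b \<odot>\<^bsub>M\<^esub> x)"
    and left_smult_one: "x \<in> carrier M \<Longrightarrow> \<one>\<^bsub>S\<^esub> \<odot>\<^bsub>M\<^esub> x = x"

definition left_module_hom ::
  "('s, 'm) ring_scheme \<Rightarrow> ('s, 'a) module \<Rightarrow> ('s, 'b) module \<Rightarrow> ('a \<Rightarrow> 'b) set"
  where "left_module_hom S M N = {f \<in> carrier M \<rightarrow> carrier N.
      (\<forall>x \<in> carrier M. \<forall>y \<in> carrier M. f (x \<oplus>\<^bsub>M\<^esub> y) = f x \<oplus>\<^bsub>N\<^esub> f y) \<and>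
      (\<forall>a \<in> carrier S. \<forall>x \<in> carrier M. f (a \<odot>\<^bsub>M\<^esub> x) = a \<odot>\<^bsub>N\<^esub> f x)}"

text \<open>The free left module \<open>S\<^sup>(\<^sup>I\<^sup>)\<close>.\<close>

definition free_left_module :: "('s, 'm) ring_scheme \<Rightarrow> 'i set \<Rightarrow> ('s, 'i \<Rightarrow> 's) module"
  where "free_left_module S I =
    \<lparr>carrier = {f \<in> I \<rightarrow>\<^sub>E carrier S. finite {i \<in> I. f i \<noteq> \<zero>\<^bsub>S\<^esub>}}, mult = undefined, one = undefined,
     zero = (\<lambda>i\<in>I. \<zero>\<^bsub>S\<^esub>), add = (\<lambda>f f'. \<lambda>i\<in>I. f i \<oplus>\<^bsub>S\<^esub> f' i),
     smult = (\<lambda>a f. \<lambda>i\<in>I. a \<otimes>\<^bsub>S\<^esub> f i)\<rparr>"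

text \<open>Projective: a direct summand of a free module. Basis sets \<open>I\<close> of elements of \<open>M\<close> suffice,
  since the images in \<open>M\<close> of a basis generate \<open>M\<close> and the surjection from the free module on
  any generating set splits.\<close>

definition projective_left_module :: "('s, 'm) ring_scheme \<Rightarrow> ('s, 'a) module \<Rightarrow> bool"
  where "projective_left_module S M \<longleftrightarrow> left_module S M \<and>
    (\<exists>(I :: 'a set) i p. i \<in> left_module_hom S M (free_left_module S I) \<and>
       p \<in> left_module_hom S (free_left_module S I) M \<and> (\<forall>x \<in> carrier M. p (i x) = x))"

text \<open>A \<open>k\<close>-algebra as a central \<open>k\<close>-bimodule, and the algebra \<open>A \<otimes>\<^sub>k B\<close> with
  \<open>(a \<otimes> b)(a' \<otimes> b') = aa' \<otimes> bb'\<close>.\<close>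

definition central_bimodule :: "('k, 'a) module \<Rightarrow> ('k, 'a) bimodule"
  where "central_bimodule A = module.extend A \<lparr>rsmult = \<lambda>x s. s \<odot>\<^bsub>A\<^esub> x\<rparr>"

definition tensor_algebra ::
  "('k, 'm) ring_scheme \<Rightarrow> ('k, 'a) module \<Rightarrow> ('k, 'b) module \<Rightarrow> ('k, ('a \<times> 'b \<Rightarrow>\<^sub>0 int) set) module"
  where "tensor_algebra k A B = (let T = tensor_class k (central_bimodule A) (central_bimodule B) in
    (module.truncate (tensor_product k (central_bimodule A) (central_bimodule B)))
      \<lparr>mult := \<lambda>w z. \<Union>s\<in>w. \<Union>t\<in>z. T (frag_extend (\<lambda>(a, b). frag_extend
           (\<lambda>(a', b'). frag_of (a \<otimes>\<^bsub>A\<^esub> a', b \<otimes>\<^bsub>B\<^esub> b')) t) s),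
       one := T (frag_of (\<one>\<^bsub>A\<^esub>, \<one>\<^bsub>B\<^esub>))\<rparr>)"

text \<open>\<open>A\<close> as a left module over \<open>A \<otimes>\<^sub>k A\<^sup>o\<^sup>p\<close>, via \<open>(a \<otimes> b)x = axb\<close>.\<close>

definition enveloping_module :: "('k, 'a) module \<Rightarrow> (('a \<times> 'a \<Rightarrow>\<^sub>0 int) set, 'a) module"
  where "enveloping_module A =
    \<lparr>carrier = carrier A, mult = mult A, one = one A, zero = zero A, add = add A,
     smult = (\<lambda>w x. tensor_lift A (\<lambda>a b. a \<otimes>\<^bsub>A\<^esub> x \<otimes>\<^bsub>A\<^esub> b) w)\<rparr>"

definition separable_algebra :: "('k, 'm) ring_scheme \<Rightarrow> ('k, 'a) module \<Rightarrow> bool"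
  where "separable_algebra k A \<longleftrightarrow> k_algebra k A \<and>
    projective_left_module (tensor_algebra k A (opposite A)) (enveloping_module A)"

definition ring_center :: "('a, 'm) ring_scheme \<Rightarrow> 'a set"
  where "ring_center A = {z \<in> carrier A. \<forall>a \<in> carrier A. z \<otimes>\<^bsub>A\<^esub> a = a \<otimes>\<^bsub>A\<^esub> z}"

definition azumaya_algebra :: "('k, 'm) ring_scheme \<Rightarrow> ('k, 'a) module \<Rightarrow> bool"
  where "azumaya_algebra k A \<longleftrightarrow> separable_algebra k A \<and>
    ring_center A = {s \<odot>\<^bsub>A\<^esub> \<one>\<^bsub>A\<^esub> | s. s \<in> carrier k}"

section \<open>Partial generalized crossed products\<close>

text \<open>\<open>\<Delta>(\<Gamma>) = \<Oplus>\<^sub>g \<Gamma>\<^sub>g\<close> for a family of \<open>R\<close>-bimodules with factor set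
  \<open>f\<^sub>g\<^sub>,\<^sub>h : \<Gamma>\<^sub>g \<otimes>\<^sub>R \<Gamma>\<^sub>h \<rightarrow> 1\<^sub>g \<star> \<Gamma>\<^sub>g\<^sub>h\<close>: the product of \<open>u\<^sub>g\<close> and \<open>v\<^sub>h\<close> is
  \<open>f\<^sub>g\<^sub>,\<^sub>h(u\<^sub>g \<otimes> v\<^sub>h)\<close>, extended additively; \<open>c \<in> \<Gamma>\<^sub>1\<close> is the unity.\<close>

definition partial_crossed_product ::
  "('g, 'n) monoid_scheme \<Rightarrow> ('r, 'm) ring_scheme \<Rightarrow> ('g \<Rightarrow> ('r, 'a) bimodule) \<Rightarrow>
    ('g \<Rightarrow> 'g \<Rightarrow> ('a \<times> 'a \<Rightarrow>\<^sub>0 int) set \<Rightarrow> 'a) \<Rightarrow> 'a \<Rightarrow> ('r, 'g \<Rightarrow> 'a) module"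
  where "partial_crossed_product G R \<Gamma> f c =
    (let S = sum_group (carrier G) (\<lambda>g. add_monoid (\<Gamma> g)) in
    \<lparr>carrier = carrier S,
     mult = (\<lambda>u v. \<lambda>k\<in>carrier G.
       finsum (\<Gamma> k) (\<lambda>(g, h). f g h (pure_tensor R (\<Gamma> g) (\<Gamma> h) (u g) (v h)))
         {(g, h). g \<in> carrier G \<and> h \<in> carrier G \<and> g \<otimes>\<^bsub>G\<^esub> h = k}),
     one = (\<lambda>k\<in>carrier G. if k = \<one>\<^bsub>G\<^esub> then c else \<zero>\<^bsub>\<Gamma> k\<^esub>),
     zero = one S, add = mult S,
     smult = (\<lambda>r u. \<lambda>k\<in>carrier G. r \<odot>\<^bsub>\<Gamma> k\<^esub> u k)\<rparr>)"

definition cocycle_set ::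
  "('g, 'n) monoid_scheme \<Rightarrow> ('a, 'm) ring_scheme \<Rightarrow> ('g \<Rightarrow> 'a) \<Rightarrow> ('g \<Rightarrow> 'a \<Rightarrow> 'a) \<Rightarrow>
    ('a, 'a) module \<Rightarrow> 'g \<Rightarrow> 'a set"
  where "cocycle_set G R e \<alpha> A g =
    {a \<in> {e (inv\<^bsub>G\<^esub> g) \<otimes>\<^bsub>A\<^esub> b | b. b \<in> carrier A}.
       \<forall>r \<in> carrier R. \<alpha> (inv\<^bsub>G\<^esub> g) (r \<otimes>\<^bsub>R\<^esub> e g) \<otimes>\<^bsub>A\<^esub> a = a \<otimes>\<^bsub>A\<^esub> r}"

text \<open>Representatives of \<open>f\<^sub>A(g) = [C\<^sub>g]\<close> and of \<open>\<Theta>(g) = [(D\<^sub>g)\<^bsub>g\<^sup>-\<^sup>1\<^esub>]\<close>, and the bimodule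
  \<open>\<Gamma>\<^sub>g\<close>. The lemma \<open>Gamma_class\<close> below shows that \<open>[\<Gamma>\<^sub>g] = f\<^sub>A(g)\<Theta>(g)\<close>.\<close>

definition cocycle_bimodule ::
  "('g, 'n) monoid_scheme \<Rightarrow> ('a, 'm) ring_scheme \<Rightarrow> ('g \<Rightarrow> 'a) \<Rightarrow> ('g \<Rightarrow> 'a \<Rightarrow> 'a) \<Rightarrow>
    ('a, 'a) module \<Rightarrow> 'g \<Rightarrow> ('a, 'a) bimodule"
  where "cocycle_bimodule G R e \<alpha> A g =
    \<lparr>carrier = cocycle_set G R e \<alpha> A g, mult = undefined, one = undefined,
     zero = zero A, add = add A,
     smult = (\<lambda>r a. \<alpha> (inv\<^bsub>G\<^esub> g) (r \<otimes>\<^bsub>R\<^esub> e g) \<otimes>\<^bsub>A\<^esub> a), rsmult = (\<lambda>a r. a \<otimes>\<^bsub>A\<^esub> r)\<rparr>"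

definition Theta_bimodule ::
  "('g, 'n) monoid_scheme \<Rightarrow> ('a, 'm) ring_scheme \<Rightarrow> ('g \<Rightarrow> 'a) \<Rightarrow> ('g \<Rightarrow> 'a \<Rightarrow> 'a) \<Rightarrow>
    'g \<Rightarrow> ('a, 'a) bimodule"
  where "Theta_bimodule G R e \<alpha> g =
    \<lparr>carrier = pdom R e g, mult = undefined, one = undefined, zero = zero R, add = add R,
     smult = (\<lambda>r d. r \<otimes>\<^bsub>R\<^esub> d), rsmult = (\<lambda>d r. d \<otimes>\<^bsub>R\<^esub> \<alpha> g (r \<otimes>\<^bsub>R\<^esub> e (inv\<^bsub>G\<^esub> g)))\<rparr>"

definition Gamma_bimodule ::
  "('g, 'n) monoid_scheme \<Rightarrow> ('a, 'm) ring_scheme \<Rightarrow> ('g \<Rightarrow> 'a) \<Rightarrow> ('g \<Rightarrow> 'a \<Rightarrow> 'a) \<Rightarrow>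
    ('a, 'a) module \<Rightarrow> 'g \<Rightarrow> ('a, 'a) bimodule"
  where "Gamma_bimodule G R e \<alpha> A g =
    \<lparr>carrier = cocycle_set G R e \<alpha> A g, mult = undefined, one = undefined,
     zero = zero A, add = add A,
     smult = (\<lambda>r a. a \<otimes>\<^bsub>A\<^esub> r), rsmult = (\<lambda>a r. r \<otimes>\<^bsub>A\<^esub> a)\<rparr>"

text \<open>The factor set \<open>\<Gamma>\<^sub>g \<otimes>\<^sub>R \<Gamma>\<^sub>h \<ni> u \<otimes> v \<mapsto> vu\<close> (product in \<^term>\<open>A\<close>), with values in
  \<open>1\<^sub>g \<star> \<Gamma>\<^sub>g\<^sub>h \<subseteq> \<Gamma>\<^sub>g\<^sub>h\<close>.\<close>

definition Gamma_factor_set ::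
  "('g, 'n) monoid_scheme \<Rightarrow> ('a, 'm) ring_scheme \<Rightarrow> ('g \<Rightarrow> 'a) \<Rightarrow> ('g \<Rightarrow> 'a \<Rightarrow> 'a) \<Rightarrow>
    ('a, 'a) module \<Rightarrow> 'g \<Rightarrow> 'g \<Rightarrow> ('a \<times> 'a \<Rightarrow>\<^sub>0 int) set \<Rightarrow> 'a"
  where "Gamma_factor_set G R e \<alpha> A g h =
    tensor_lift (Gamma_bimodule G R e \<alpha> A (g \<otimes>\<^bsub>G\<^esub> h)) (\<lambda>u v. v \<otimes>\<^bsub>A\<^esub> u)"

definition Delta_Gamma ::
  "('g, 'n) monoid_scheme \<Rightarrow> ('a, 'm) ring_scheme \<Rightarrow> ('g \<Rightarrow> 'a) \<Rightarrow> ('g \<Rightarrow> 'a \<Rightarrow> 'a) \<Rightarrow>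
    ('a, 'a) module \<Rightarrow> ('a, 'g \<Rightarrow> 'a) module"
  where "Delta_Gamma G R e \<alpha> A =
    partial_crossed_product G R (Gamma_bimodule G R e \<alpha> A) (Gamma_factor_set G R e \<alpha> A) \<one>\<^bsub>A\<^esub>"

section \<open>The classes of the bimodules \<open>\<Gamma>\<^sub>g\<close>\<close>

text \<open>The isomorphism \<open>C\<^sub>g \<otimes>\<^sub>R (D\<^sub>g)\<^bsub>g\<^sup>-\<^sup>1\<^esub> \<cong> \<Gamma>\<^sub>g\<close> is \<open>c \<otimes> d \<mapsto> cd\<close>.\<close>

lemma frag_eval_of:
  assumes "abelian_group P" "f x \<in> carrier P"
  shows "frag_eval P f (frag_of x) = f x"
proof -
  interpret P: abelian_group P by fact
  show ?thesis using assms by (simp add: frag_eval_def P.finsum_insert[of "{}" x, simplified])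
qed

lemma frag_eval_superset:
  assumes "abelian_group P" "\<And>x. x \<in> S \<Longrightarrow> f x \<in> carrier P" "finite S" "Poly_Mapping.keys t \<subseteq> S"
  shows "frag_eval P f t = (\<Oplus>\<^bsub>P\<^esub>p\<in>S. [Poly_Mapping.lookup t p] \<cdot>\<^bsub>P\<^esub> f p)"
proof -
  interpret P: abelian_group P by fact
  have [simp]: "[(0::int)] \<cdot>\<^bsub>P\<^esub> x = \<zero>\<^bsub>P\<^esub>" for x by (simp add: add_pow_def)
  show ?thesis unfolding frag_eval_def
    by (rule P.add.finprod_mono_neutral_cong_left) (use assms in \<open>auto simp: in_keys_iff\<close>)
qed

lemma frag_eval_closed:
  assumes "abelian_group P" "\<And>x. x \<in> S \<Longrightarrow> f x \<in> carrier P" "Poly_Mapping.keys t \<subseteq> S"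
  shows "frag_eval P f t \<in> carrier P"
proof -
  interpret P: abelian_group P by fact
  show ?thesis unfolding frag_eval_def
    by (rule P.finsum_closed) (use assms in auto)
qed

lemma frag_eval_add:
  assumes "abelian_group P" "\<And>x. x \<in> S \<Longrightarrow> f x \<in> carrier P" "Poly_Mapping.keys s \<subseteq> S" "Poly_Mapping.keys t \<subseteq> S"
  shows "frag_eval P f (s + t) = frag_eval P f s \<oplus>\<^bsub>P\<^esub> frag_eval P f t"
proof -
  interpret P: abelian_group P by fact
  let ?U = "Poly_Mapping.keys s \<union> Poly_Mapping.keys t"
  have f: "\<And>x. x \<in> ?U \<Longrightarrow> f x \<in> carrier P" using assms by blast
  have "frag_eval P f (s + t) = (\<Oplus>\<^bsub>P\<^esub>p\<in>?U. [Poly_Mapping.lookup (s + t) p] \<cdot>\<^bsub>P\<^esub> f p)"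
    by (rule frag_eval_superset) (use assms f keys_add[of s t] in auto)
  also have "\<dots> = (\<Oplus>\<^bsub>P\<^esub>p\<in>?U. [Poly_Mapping.lookup s p] \<cdot>\<^bsub>P\<^esub> f p \<oplus>\<^bsub>P\<^esub> [Poly_Mapping.lookup t p] \<cdot>\<^bsub>P\<^esub> f p)"
    by (rule P.finsum_cong') (use f in \<open>auto simp: lookup_add P.add.int_pow_mult\<close>)
  also have "\<dots> = (\<Oplus>\<^bsub>P\<^esub>p\<in>?U. [Poly_Mapping.lookup s p] \<cdot>\<^bsub>P\<^esub> f p) \<oplus>\<^bsub>P\<^esub> (\<Oplus>\<^bsub>P\<^esub>p\<in>?U. [Poly_Mapping.lookup t p] \<cdot>\<^bsub>P\<^esub> f p)"
    by (rule P.finsum_addf) (use f in auto)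
  also have "\<dots> = frag_eval P f s \<oplus>\<^bsub>P\<^esub> frag_eval P f t"
    by (subst (1 2) frag_eval_superset[OF assms(1) f]) auto
  finally show ?thesis .
qed

lemma frag_eval_0: "frag_eval P f 0 = \<zero>\<^bsub>P\<^esub>" if "abelian_group P"
proof -
  interpret P: abelian_group P by fact
  show ?thesis by (simp add: frag_eval_def)
qed

lemma frag_eval_diff:
  assumes "abelian_group P" "\<And>x. x \<in> S \<Longrightarrow> f x \<in> carrier P" "Poly_Mapping.keys s \<subseteq> S" "Poly_Mapping.keys t \<subseteq> S"
  shows "frag_eval P f (s - t) = frag_eval P f s \<ominus>\<^bsub>P\<^esub> frag_eval P f t"
proof -
  interpret P: abelian_group P by fact
  have k: "Poly_Mapping.keys (s - t) \<subseteq> S" using assms(3,4) keys_diff[of s t] by blast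
  have "frag_eval P f (s - t + t) = frag_eval P f (s - t) \<oplus>\<^bsub>P\<^esub> frag_eval P f t"
    by (rule frag_eval_add[OF assms(1,2) k assms(4)])
  then show ?thesis
    using frag_eval_closed[OF assms(1,2) k] frag_eval_closed[OF assms(1,2) assms(3)] frag_eval_closed[OF assms(1,2) assms(4)]
    by (simp add: a_minus_def P.a_assoc P.r_neg)
qed

locale tensor_pair =
  fixes R :: "('r, 'm) ring_scheme" and M :: "('r, 'a) bimodule" and N :: "('r, 'b) bimodule"
  assumes M: "abelian_group M" and N: "abelian_group N"
    and ract: "\<And>x r. x \<in> carrier M \<Longrightarrow> r \<in> carrier R \<Longrightarrow> rsmult M x r \<in> carrier M"
    and lact: "\<And>y r. y \<in> carrier N \<Longrightarrow> r \<in> carrier R \<Longrightarrow> r \<odot>\<^bsub>N\<^esub> y \<in> carrier N"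
begin

sublocale M: abelian_group M by (rule M)
sublocale N: abelian_group N by (rule N)

abbreviation "F \<equiv> free_Abelian_group (carrier M \<times> carrier N)"
abbreviation "K \<equiv> tensor_kernel R M N"
abbreviation "cl \<equiv> tensor_class R M N"

sublocale F: comm_group F by (rule abelian_free_Abelian_group)

lemma rel_sub: "tensor_relations R M N \<subseteq> carrier F"
proof -
  have d: "Poly_Mapping.keys (a - b) \<subseteq> S" if "Poly_Mapping.keys a \<subseteq> S" "Poly_Mapping.keys b \<subseteq> S" for a b :: "'a \<times> 'b \<Rightarrow>\<^sub>0 int" and S
    using that keys_diff[of a b] by blast
  show ?thesis unfolding tensor_relations_def
    by (rule subsetI, elim UnE CollectE exE conjE) (simp_all add: d ract lact)
qed

lemma K_subgroup: "subgroup K F"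
  unfolding tensor_kernel_def by (rule F.generate_is_subgroup[OF rel_sub])

lemma K_sub: "t \<in> K \<Longrightarrow> Poly_Mapping.keys t \<subseteq> carrier M \<times> carrier N"
  using subsetD[OF subgroup.subset[OF K_subgroup], of t] by simp

lemma K_normal: "normal K F" by (rule F.subgroup_imp_normal[OF K_subgroup])

lemma K_0: "0 \<in> K" using subgroup.one_closed[OF K_subgroup] by simp
lemma K_add: "s \<in> K \<Longrightarrow> t \<in> K \<Longrightarrow> s + t \<in> K" using subgroup.m_closed[OF K_subgroup] by simp
lemma K_diff: "s \<in> K \<Longrightarrow> t \<in> K \<Longrightarrow> s - t \<in> K"
  using subgroup.m_inv_closed[OF K_subgroup, of t] K_add[of s "- t"] K_sub by (simp add: K_sub)

lemma K_induct [consumes 1]: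
  assumes "t \<in> K" "P 0" "\<And>s. s \<in> tensor_relations R M N \<Longrightarrow> P s"
    "\<And>s t. s \<in> K \<Longrightarrow> t \<in> K \<Longrightarrow> P s \<Longrightarrow> P t \<Longrightarrow> P (s + t)" "\<And>s. s \<in> K \<Longrightarrow> P s \<Longrightarrow> P (- s)"
  shows "P t"
  using assms(1) unfolding tensor_kernel_def
proof (induction rule: generate.induct)
  case one then show ?case using assms by simp
next
  case (incl h) then show ?case using assms by simp
next
  case (inv h) 
  then have "h \<in> K" unfolding tensor_kernel_def by (rule generate.incl)
  then show ?case using inv assms K_sub[of h] by simp
next
  case (eng h1 h2) then show ?case using assms by (simp add: tensor_kernel_def)
qed

lemma class_eq: "cl t = {k + t | k. k \<in> K}"
  by (auto simp: tensor_class_def r_coset_def)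

lemma class_mem: "s \<in> cl t \<longleftrightarrow> s - t \<in> K"
  unfolding class_eq by (auto intro: exI[of _ "s - t"])

lemma class_eq_iff: "cl s = cl t \<longleftrightarrow> s - t \<in> K"
proof
  assume "cl s = cl t" then have "s \<in> cl t" using class_mem[of s s] K_0 by auto
  then show "s - t \<in> K" by (simp add: class_mem)
next
  assume st: "s - t \<in> K"
  show "cl s = cl t"
  proof (rule Set.set_eqI)
    fix x
    have "x - s = (x - t) - (s - t)" "x - t = (x - s) + (s - t)" by simp_all
    then show "x \<in> cl s \<longleftrightarrow> x \<in> cl t" unfolding class_mem using st K_add K_diff by metis
  qed
qed

lemma class_self: "t \<in> cl t" by (simp add: class_mem K_0)

lemma class_add: "cl s \<oplus>\<^bsub>tensor_product R M N\<^esub> cl t = cl (s + t)"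
  if "Poly_Mapping.keys s \<subseteq> carrier M \<times> carrier N" "Poly_Mapping.keys t \<subseteq> carrier M \<times> carrier N"
  unfolding tensor_product_def tensor_group_def tensor_class_def
  using normal.rcos_sum[OF K_normal, of s t] that by (simp add: FactGroup_def)

lemma carrier_tensor: "carrier (tensor_product R M N) = cl ` carrier F"
  unfolding tensor_product_def tensor_group_def tensor_class_def
  by (auto simp: FactGroup_def RCOSETS_def)

lemma tensor_lift_class:
  assumes P: "abelian_group P" and b: "\<And>x y. x \<in> carrier M \<Longrightarrow> y \<in> carrier N \<Longrightarrow> b x y \<in> carrier P"
    and bl: "\<And>x x' y. \<lbrakk>x \<in> carrier M; x' \<in> carrier M; y \<in> carrier N\<rbrakk> \<Longrightarrow> b (x \<oplus>\<^bsub>M\<^esub> x') y = b x y \<oplus>\<^bsub>P\<^esub> b x' y"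
    and br: "\<And>x y y'. \<lbrakk>x \<in> carrier M; y \<in> carrier N; y' \<in> carrier N\<rbrakk> \<Longrightarrow> b x (y \<oplus>\<^bsub>N\<^esub> y') = b x y \<oplus>\<^bsub>P\<^esub> b x y'"
    and bb: "\<And>x r y. \<lbrakk>x \<in> carrier M; r \<in> carrier R; y \<in> carrier N\<rbrakk> \<Longrightarrow> b (rsmult M x r) y = b x (r \<odot>\<^bsub>N\<^esub> y)"
    and t: "Poly_Mapping.keys t \<subseteq> carrier M \<times> carrier N"
  shows "tensor_lift P b (cl t) = frag_eval P (\<lambda>(x, y). b x y) t"
proof -
  interpret P: abelian_group P by fact
  let ?S = "carrier M \<times> carrier N" and ?f = "\<lambda>(x, y). b x y"
  have f: "\<And>p. p \<in> ?S \<Longrightarrow> ?f p \<in> carrier P" using b by auto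
  have pab: "(p \<oplus>\<^bsub>P\<^esub> q) \<oplus>\<^bsub>P\<^esub> \<ominus>\<^bsub>P\<^esub> p \<oplus>\<^bsub>P\<^esub> \<ominus>\<^bsub>P\<^esub> q = \<zero>\<^bsub>P\<^esub>" if "p \<in> carrier P" "q \<in> carrier P" for p q
    using that by (metis P.a_assoc P.a_comm P.add.inv_closed P.add.m_closed P.r_neg P.r_zero)
  note d = frag_eval_diff[OF P f] frag_eval_of[OF P] 
  have k: "Poly_Mapping.keys (a - b) \<subseteq> S" if "Poly_Mapping.keys a \<subseteq> S" "Poly_Mapping.keys b \<subseteq> S" for a b :: "'a \<times> 'b \<Rightarrow>\<^sub>0 int" and S
    using that keys_diff[of a b] by blast
  have z: "frag_eval P ?f s = \<zero>\<^bsub>P\<^esub>" if "s \<in> K" for s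
    using that
  proof (induction rule: K_induct)
    case 1 show ?case by (rule frag_eval_0[OF P])
  next
    case (2 s)
    then show ?case unfolding tensor_relations_def
      by (auto simp: d k ract lact b bl br bb a_minus_def pab P.r_neg)
  next
    case (3 s t)
    then show ?case using frag_eval_add[OF P f K_sub K_sub] by simp
  next
    case (4 s)
    have "frag_eval P ?f (0 - s) = \<zero>\<^bsub>P\<^esub>"
      by (subst frag_eval_diff[OF P f]) (use 4 K_sub in \<open>auto simp: frag_eval_0[OF P] a_minus_def\<close>)
    then show ?case by simp
  qed
  have "frag_eval P ?f s = frag_eval P ?f t" if "s \<in> cl t" for s
  proof -
    have "s - t \<in> K" using that by (simp add: class_mem)
    moreover have "frag_eval P ?f (s - t + t) = frag_eval P ?f (s - t) \<oplus>\<^bsub>P\<^esub> frag_eval P ?f t"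
      by (rule frag_eval_add[OF P f K_sub t]) (use calculation in auto)
    ultimately show ?thesis using z frag_eval_closed[OF P f t] by simp
  qed
  then have "frag_eval P ?f ` cl t = {frag_eval P ?f t}" using class_self by blast
  then show ?thesis by (simp add: tensor_lift_def)
qed

lemma carrier_cases:
  assumes "w \<in> carrier (tensor_product R M N)"
  obtains t where "Poly_Mapping.keys t \<subseteq> carrier M \<times> carrier N" "w = cl t"
  using assms that unfolding carrier_tensor by force

lemma extend_K:
  assumes "t \<in> K" "\<And>s. s \<in> tensor_relations R M N \<Longrightarrow> frag_extend q s \<in> K"
  shows "frag_extend q t \<in> K"
  using assms(1)
proof (induction rule: K_induct)
  case 1 show ?case by (simp add: K_0)
next
  case (2 s) then show ?case by (rule assms(2))
next
  case (3 s t) then show ?case by (simp add: frag_extend_add K_add)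
next
  case (4 s) then show ?case using K_diff[OF K_0, of "frag_extend q s"] by (simp add: frag_extend_minus)
qed

lemma union_class:
  assumes "\<And>s. s \<in> tensor_relations R M N \<Longrightarrow> frag_extend q s \<in> K"
  shows "(\<Union>s\<in>cl t. cl (frag_extend q s)) = cl (frag_extend q t)"
proof -
  have "cl (frag_extend q s) = cl (frag_extend q t)" if "s \<in> cl t" for s
    using extend_K[OF _ assms, of "s - t"] that by (simp add: class_eq_iff class_mem frag_extend_diff)
  then show ?thesis using class_self by blast
qed

lemma rel_l: "\<lbrakk>x \<in> carrier M; x' \<in> carrier M; y \<in> carrier N\<rbrakk> \<Longrightarrow>
    frag_of (x \<oplus>\<^bsub>M\<^esub> x', y) - frag_of (x, y) - frag_of (x', y) \<in> K"
  unfolding tensor_kernel_def tensor_relations_def by (rule generate.incl) blast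
lemma rel_r: "\<lbrakk>x \<in> carrier M; y \<in> carrier N; y' \<in> carrier N\<rbrakk> \<Longrightarrow>
    frag_of (x, y \<oplus>\<^bsub>N\<^esub> y') - frag_of (x, y) - frag_of (x, y') \<in> K"
  unfolding tensor_kernel_def tensor_relations_def by (rule generate.incl) blast
lemma rel_b: "\<lbrakk>x \<in> carrier M; r \<in> carrier R; y \<in> carrier N\<rbrakk> \<Longrightarrow>
    frag_of (rsmult M x r, y) - frag_of (x, r \<odot>\<^bsub>N\<^esub> y) \<in> K"
  unfolding tensor_kernel_def tensor_relations_def by (rule generate.incl) blast

lemma rel_elim:
  assumes "s \<in> tensor_relations R M N"
   "\<And>x x' y. \<lbrakk>x \<in> carrier M; x' \<in> carrier M; y \<in> carrier N\<rbrakk> \<Longrightarrow>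
    P (frag_of (x \<oplus>\<^bsub>M\<^esub> x', y) - frag_of (x, y) - frag_of (x', y))"
  "\<And>x y y'. \<lbrakk>x \<in> carrier M; y \<in> carrier N; y' \<in> carrier N\<rbrakk> \<Longrightarrow>
    P (frag_of (x, y \<oplus>\<^bsub>N\<^esub> y') - frag_of (x, y) - frag_of (x, y'))"
  "\<And>x r y. \<lbrakk>x \<in> carrier M; r \<in> carrier R; y \<in> carrier N\<rbrakk> \<Longrightarrow>
    P (frag_of (rsmult M x r, y) - frag_of (x, r \<odot>\<^bsub>N\<^esub> y))"
  shows "P s"
  using assms(1) unfolding tensor_relations_def
  by (elim UnE CollectE exE conjE) (simp_all only: assms(2-4))

end

lemma tensor_acts:
  "r \<odot>\<^bsub>tensor_product R M N\<^esub> w =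
     (\<Union>t\<in>w. tensor_class R M N (frag_extend (\<lambda>(x, y). frag_of (r \<odot>\<^bsub>M\<^esub> x, y)) t))"
  "rsmult (tensor_product R M N) w r =
     (\<Union>t\<in>w. tensor_class R M N (frag_extend (\<lambda>(x, y). frag_of (x, rsmult N y r)) t))"
  by (simp_all add: tensor_product_def)

locale contained_partial_action =
  fixes G :: "('g, 'n) monoid_scheme" and R :: "('a, 'm) ring_scheme"
    and e :: "'g \<Rightarrow> 'a" and \<alpha> :: "'g \<Rightarrow> 'a \<Rightarrow> 'a" and A :: "('a, 'a) module"
  assumes pact: "unital_partial_action G R e \<alpha>" and rA: "ring A"
    and sub: "carrier R \<subseteq> carrier A" and hom: "(\<lambda>x. x) \<in> ring_hom R A"
begin

sublocale U: unital_partial_action G R e \<alpha> by (rule pact)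
sublocale A: ring A by (rule rA)

lemma sub': "x \<in> carrier R \<Longrightarrow> x \<in> carrier A" using sub by auto
lemma Rmult: "\<lbrakk>x \<in> carrier R; y \<in> carrier R\<rbrakk> \<Longrightarrow> x \<otimes>\<^bsub>R\<^esub> y = x \<otimes>\<^bsub>A\<^esub> y" using ring_hom_mult[OF hom] .
lemma Radd: "\<lbrakk>x \<in> carrier R; y \<in> carrier R\<rbrakk> \<Longrightarrow> x \<oplus>\<^bsub>R\<^esub> y = x \<oplus>\<^bsub>A\<^esub> y" using ring_hom_add[OF hom] .

lemma pdom_R: "g \<in> carrier G \<Longrightarrow> x \<in> pdom R e g \<Longrightarrow> x \<in> carrier R"
  by (auto simp: pdom_def cgenideal_def U.idem_closed)
lemma pdom_I: "r \<in> carrier R \<Longrightarrow> r \<otimes>\<^bsub>R\<^esub> e g \<in> pdom R e g"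
  by (auto simp: pdom_def cgenideal_def)
lemma pdom_e: "g \<in> carrier G \<Longrightarrow> x \<in> pdom R e g \<Longrightarrow> x \<otimes>\<^bsub>R\<^esub> e g = x"
  by (auto simp: pdom_def cgenideal_def U.idem_closed U.idem U.R.m_assoc)
lemma pdom_mult: "g \<in> carrier G \<Longrightarrow> x \<in> pdom R e g \<Longrightarrow> r \<in> carrier R \<Longrightarrow> r \<otimes>\<^bsub>R\<^esub> x \<in> pdom R e g"
  by (metis pdom_I pdom_R pdom_e U.R.m_assoc U.R.m_closed U.idem_closed)
lemma pdom_mult': "g \<in> carrier G \<Longrightarrow> x \<in> pdom R e g \<Longrightarrow> r \<in> carrier R \<Longrightarrow> x \<otimes>\<^bsub>R\<^esub> r \<in> pdom R e g"
  by (metis pdom_mult pdom_R U.R.m_comm)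
lemma e_pdom: "g \<in> carrier G \<Longrightarrow> e g \<in> pdom R e g"
  using pdom_I[of "e g" g] by (simp add: U.idem U.idem_closed)
lemma pdom_ideal: "g \<in> carrier G \<Longrightarrow> ideal (pdom R e g) R"
  unfolding pdom_def by (rule U.R.cgenideal_ideal) (rule U.idem_closed)

lemma act_closed: "g \<in> carrier G \<Longrightarrow> x \<in> pdom R e (inv\<^bsub>G\<^esub> g) \<Longrightarrow> \<alpha> g x \<in> pdom R e g"
  using U.iso[of g] by (auto simp: ring_iso_def ring_hom_def pdom_ring_def)
lemma act_e: "g \<in> carrier G \<Longrightarrow> \<alpha> g (e (inv\<^bsub>G\<^esub> g)) = e g"
  using U.iso[of g] by (auto simp: ring_iso_def ring_hom_def pdom_ring_def)

end

locale contained_partial_action_at = contained_partial_action G R e \<alpha> A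
  for G :: "('g, 'n) monoid_scheme" and R :: "('a, 'm) ring_scheme"
    and e :: "'g \<Rightarrow> 'a" and \<alpha> :: "'g \<Rightarrow> 'a \<Rightarrow> 'a" and A :: "('a, 'a) module" +
  fixes g :: 'g
  assumes g: "g \<in> carrier G"
begin

abbreviation (input) "C \<equiv> cocycle_set G R e \<alpha> A g"
abbreviation (input) "CB \<equiv> cocycle_bimodule G R e \<alpha> A g"
abbreviation (input) "TB \<equiv> Theta_bimodule G R e \<alpha> g"
abbreviation (input) "GB \<equiv> Gamma_bimodule G R e \<alpha> A g"

lemma ig: "inv\<^bsub>G\<^esub> g \<in> carrier G" using g by simp

lemma C_A: "c \<in> C \<Longrightarrow> c \<in> carrier A"
  by (auto simp: cocycle_set_def ig U.idem_closed sub')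
lemma C_tw: "c \<in> C \<Longrightarrow> r \<in> carrier R \<Longrightarrow> \<alpha> (inv\<^bsub>G\<^esub> g) (r \<otimes>\<^bsub>R\<^esub> e g) \<otimes>\<^bsub>A\<^esub> c = c \<otimes>\<^bsub>A\<^esub> r"
  by (auto simp: cocycle_set_def)
lemma C_e: "c \<in> C \<Longrightarrow> e (inv\<^bsub>G\<^esub> g) \<otimes>\<^bsub>A\<^esub> c = c"
  by (auto simp: cocycle_set_def A.m_assoc[symmetric] sub' ig U.idem_closed Rmult[symmetric] U.idem)
lemma C_I: "c \<in> carrier A \<Longrightarrow> e (inv\<^bsub>G\<^esub> g) \<otimes>\<^bsub>A\<^esub> c = c \<Longrightarrow>
   (\<And>r. r \<in> carrier R \<Longrightarrow> \<alpha> (inv\<^bsub>G\<^esub> g) (r \<otimes>\<^bsub>R\<^esub> e g) \<otimes>\<^bsub>A\<^esub> c = c \<otimes>\<^bsub>A\<^esub> r) \<Longrightarrow> c \<in> C"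
  by (auto simp: cocycle_set_def intro: exI[of _ c])
lemma a_A: "r \<in> carrier R \<Longrightarrow> \<alpha> (inv\<^bsub>G\<^esub> g) (r \<otimes>\<^bsub>R\<^esub> e g) \<in> carrier A"
  using act_closed[OF ig, of "r \<otimes>\<^bsub>R\<^esub> e g"] pdom_I[of r g] pdom_R[OF ig] g sub' by simp
lemma e_A: "e (inv\<^bsub>G\<^esub> g) \<in> carrier A" using U.idem_closed[OF ig] sub' by simp
lemma C_eg: "c \<in> C \<Longrightarrow> c \<otimes>\<^bsub>A\<^esub> e g = c"
  using C_tw[of c "e g"] act_e[OF ig] C_e by (simp add: U.idem U.idem_closed g)

lemma C_add: "c \<oplus>\<^bsub>A\<^esub> d \<in> C" if cd: "c \<in> C" "d \<in> C"
proof (rule C_I)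
  show "c \<oplus>\<^bsub>A\<^esub> d \<in> carrier A" using cd[THEN C_A] by (rule A.a_closed)
  show "e (inv\<^bsub>G\<^esub> g) \<otimes>\<^bsub>A\<^esub> (c \<oplus>\<^bsub>A\<^esub> d) = c \<oplus>\<^bsub>A\<^esub> d"
    unfolding A.r_distr[OF cd[THEN C_A] e_A] cd[THEN C_e] by (rule refl)
  fix r assume r: "r \<in> carrier R"
  show "\<alpha> (inv\<^bsub>G\<^esub> g) (r \<otimes>\<^bsub>R\<^esub> e g) \<otimes>\<^bsub>A\<^esub> (c \<oplus>\<^bsub>A\<^esub> d) = (c \<oplus>\<^bsub>A\<^esub> d) \<otimes>\<^bsub>A\<^esub> r"
    unfolding A.r_distr[OF cd[THEN C_A] a_A[OF r]] A.l_distr[OF cd[THEN C_A] sub'[OF r]]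
      C_tw[OF cd(1) r] C_tw[OF cd(2) r] by (rule refl)
qed
lemma C_zero: "\<zero>\<^bsub>A\<^esub> \<in> C"
  by (rule C_I) (simp_all add: e_A a_A sub')
lemma C_neg: "\<ominus>\<^bsub>A\<^esub> c \<in> C" if c: "c \<in> C"
proof (rule C_I)
  show "\<ominus>\<^bsub>A\<^esub> c \<in> carrier A" using C_A[OF c] by (rule A.a_inv_closed)
  show "e (inv\<^bsub>G\<^esub> g) \<otimes>\<^bsub>A\<^esub> (\<ominus>\<^bsub>A\<^esub> c) = \<ominus>\<^bsub>A\<^esub> c"
    unfolding A.r_minus[OF e_A C_A[OF c]] C_e[OF c] by (rule refl)
  fix r assume r: "r \<in> carrier R"
  show "\<alpha> (inv\<^bsub>G\<^esub> g) (r \<otimes>\<^bsub>R\<^esub> e g) \<otimes>\<^bsub>A\<^esub> (\<ominus>\<^bsub>A\<^esub> c) = (\<ominus>\<^bsub>A\<^esub> c) \<otimes>\<^bsub>A\<^esub> r"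
    unfolding A.r_minus[OF a_A[OF r] C_A[OF c]] A.l_minus[OF C_A[OF c] sub'[OF r]] C_tw[OF c r] by (rule refl)
qed
lemma C_mult: "c \<in> C \<Longrightarrow> r \<in> carrier R \<Longrightarrow> c \<otimes>\<^bsub>A\<^esub> r \<in> C"
proof (rule C_I)
  fix s assume c: "c \<in> C" and r: "r \<in> carrier R" and s: "s \<in> carrier R"
  have "\<alpha> (inv\<^bsub>G\<^esub> g) (s \<otimes>\<^bsub>R\<^esub> e g) \<otimes>\<^bsub>A\<^esub> (c \<otimes>\<^bsub>A\<^esub> r) = c \<otimes>\<^bsub>A\<^esub> (s \<otimes>\<^bsub>A\<^esub> r)"
    using c r s by (simp add: A.m_assoc[symmetric] a_A C_A sub' C_tw)
  then show "\<alpha> (inv\<^bsub>G\<^esub> g) (s \<otimes>\<^bsub>R\<^esub> e g) \<otimes>\<^bsub>A\<^esub> (c \<otimes>\<^bsub>A\<^esub> r) = c \<otimes>\<^bsub>A\<^esub> r \<otimes>\<^bsub>A\<^esub> s"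
    using c r s by (simp add: A.m_assoc C_A sub' Rmult[symmetric] U.R.m_comm)
qed (simp_all add: C_A sub' A.m_assoc[symmetric] e_A C_e)

lemma ab_sub: "abelian_group B" if "carrier B \<subseteq> carrier A" "add B = add A" "zero B = zero A" "\<zero>\<^bsub>A\<^esub> \<in> carrier B"
   "\<And>c d. c \<in> carrier B \<Longrightarrow> d \<in> carrier B \<Longrightarrow> c \<oplus>\<^bsub>A\<^esub> d \<in> carrier B" 
   "\<And>c. c \<in> carrier B \<Longrightarrow> \<ominus>\<^bsub>A\<^esub> c \<in> carrier B" for B :: "('a, 'z) ring_scheme"
proof (rule abelian_groupI)
  fix x assume "x \<in> carrier B" 
  then show "\<exists>y\<in>carrier B. y \<oplus>\<^bsub>B\<^esub> x = \<zero>\<^bsub>B\<^esub>" using that by (intro bexI[of _ "\<ominus>\<^bsub>A\<^esub> x"]) (auto simp: A.l_neg)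
qed (use that in \<open>auto simp: A.a_assoc A.a_comm A.a_lcomm subset_iff\<close>)

lemma CB_ab: "abelian_group CB" 
  by (rule ab_sub) (auto simp: cocycle_bimodule_def C_A C_add C_zero C_neg)
lemma GB_ab: "abelian_group GB" 
  by (rule ab_sub) (auto simp: Gamma_bimodule_def C_A C_add C_zero C_neg)
lemma TB_ab: "abelian_group TB"
proof -
  interpret I: ideal "pdom R e g" R by (rule pdom_ideal[OF g])
  show ?thesis
  proof (rule abelian_groupI)
    fix x assume "x \<in> carrier TB"
    then show "\<exists>y\<in>carrier TB. y \<oplus>\<^bsub>TB\<^esub> x = \<zero>\<^bsub>TB\<^esub>"
      by (intro bexI[of _ "\<ominus>\<^bsub>R\<^esub> x"]) (auto simp: Theta_bimodule_def U.R.l_neg pdom_R[OF g])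
  qed (auto simp: Theta_bimodule_def U.R.a_assoc U.R.a_comm pdom_R[OF g] U.R.add.m_lcomm)
qed

lemma pair: "tensor_pair R CB TB"
  by (rule tensor_pair.intro[OF CB_ab TB_ab])
    (simp_all add: cocycle_bimodule_def Theta_bimodule_def C_mult pdom_mult[OF g])

sublocale T: tensor_pair R CB TB by (rule pair)

abbreviation (input) "b \<equiv> (\<lambda>c d. c \<otimes>\<^bsub>A\<^esub> d)"
abbreviation (input) "bb \<equiv> (\<lambda>(c, d). c \<otimes>\<^bsub>A\<^esub> d)"
abbreviation (input) "S \<equiv> carrier CB \<times> carrier TB"

lemma carr [simp]: "carrier CB = C" "carrier TB = pdom R e g" "carrier GB = C"
  "add CB = add A" "add GB = add A" "add TB = add R" "zero GB = zero A" "zero CB = zero A" "zero TB = zero R"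
  "smult CB r c = \<alpha> (inv\<^bsub>G\<^esub> g) (r \<otimes>\<^bsub>R\<^esub> e g) \<otimes>\<^bsub>A\<^esub> c" "rsmult CB c r = c \<otimes>\<^bsub>A\<^esub> r"
  "smult TB r x = r \<otimes>\<^bsub>R\<^esub> x" "rsmult TB x r = x \<otimes>\<^bsub>R\<^esub> \<alpha> g (r \<otimes>\<^bsub>R\<^esub> e (inv\<^bsub>G\<^esub> g))"
  "smult GB r c = c \<otimes>\<^bsub>A\<^esub> r" "rsmult GB c r = r \<otimes>\<^bsub>A\<^esub> c"
  by (simp_all add: cocycle_bimodule_def Theta_bimodule_def Gamma_bimodule_def)

lemmas DR = pdom_R[OF g]
lemma DA: "x \<in> pdom R e g \<Longrightarrow> x \<in> carrier A" using DR sub' by blast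

lemma bb_C: "p \<in> S \<Longrightarrow> bb p \<in> carrier GB"
  by (auto simp: C_mult DR)

lemma lift: "Poly_Mapping.keys t \<subseteq> S \<Longrightarrow> tensor_lift GB b (T.cl t) = frag_eval GB bb t"
  by (rule T.tensor_lift_class[OF GB_ab])
    (simp_all add: C_mult DR DA C_A A.l_distr A.r_distr Radd Rmult A.m_assoc sub')

lemma ev_C: "frag_eval GB bb t \<in> C" if "Poly_Mapping.keys t \<subseteq> S"
proof -
  have "frag_eval GB bb t \<in> carrier GB"
    by (rule frag_eval_closed[OF GB_ab bb_C that])
  then show ?thesis by simp
qed

lemma ev_diff: "Poly_Mapping.keys s \<subseteq> S \<Longrightarrow> Poly_Mapping.keys t \<subseteq> S \<Longrightarrow>
   frag_eval GB bb (s - t) = frag_eval GB bb s \<ominus>\<^bsub>A\<^esub> frag_eval GB bb t"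
proof -
  assume st: "Poly_Mapping.keys s \<subseteq> S" "Poly_Mapping.keys t \<subseteq> S"
  interpret GG: abelian_group GB by (rule GB_ab)
  have k: "Poly_Mapping.keys (s - t) \<subseteq> S" using st keys_diff[of s t] by blast
  have "frag_eval GB bb (s - t + t) = frag_eval GB bb (s - t) \<oplus>\<^bsub>A\<^esub> frag_eval GB bb t"
    using frag_eval_add[OF GB_ab bb_C k st(2)] by simp
  then show ?thesis using ev_C[OF st(1)] ev_C[OF st(2)] ev_C[OF k] C_A
    by (simp add: a_minus_def A.a_assoc A.r_neg)
qed

lemma ev_normal: "Poly_Mapping.keys t \<subseteq> S \<Longrightarrow> t - frag_of (frag_eval GB bb t, e g) \<in> T.K"
proof (induction rule: free_Abelian_group_induct[consumes 1])
  case 1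
  have "frag_of (\<zero>\<^bsub>A\<^esub> \<oplus>\<^bsub>A\<^esub> \<zero>\<^bsub>A\<^esub>, e g) - frag_of (\<zero>\<^bsub>A\<^esub>, e g) - frag_of (\<zero>\<^bsub>A\<^esub>, e g) \<in> T.K"
    using T.rel_l[of "\<zero>\<^bsub>A\<^esub>" "\<zero>\<^bsub>A\<^esub>" "e g"] by (simp add: C_zero e_pdom[OF g])
  then show ?case by (simp add: frag_eval_0[OF GB_ab])
next
  case (2 x y)
  let ?x = "frag_eval GB bb x" and ?y = "frag_eval GB bb y"
  let ?z = "?x \<ominus>\<^bsub>A\<^esub> ?y"
  have c: "?x \<in> C" "?y \<in> C" using ev_C 2 by auto
  then have cz: "?z \<in> C" by (simp add: a_minus_def C_add C_neg)
  have z: "?z \<oplus>\<^bsub>A\<^esub> ?y = ?x" using c C_A by (simp add: a_minus_def A.a_assoc A.l_neg)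
  have r: "frag_of (?x, e g) - frag_of (?z, e g) - frag_of (?y, e g) \<in> T.K"
    using T.rel_l[of ?z ?y "e g"] cz c by (simp add: e_pdom[OF g] z)
  have "(x - frag_of (?x, e g)) - (y - frag_of (?y, e g)) + (frag_of (?x, e g) - frag_of (?z, e g) - frag_of (?y, e g)) \<in> T.K"
    using 2 r T.K_diff T.K_add by blast
  then show ?case by (simp add: ev_diff[OF 2(1,2)] algebra_simps)
next
  case (3 a)
  obtain c d where a: "a = (c, d)" "c \<in> C" "d \<in> pdom R e g" using 3 by auto
  have "frag_eval GB bb (frag_of a) = c \<otimes>\<^bsub>A\<^esub> d"
    using frag_eval_of[OF GB_ab, of bb a] a C_mult DR by simp
  moreover have "frag_of (c \<otimes>\<^bsub>A\<^esub> d, e g) - frag_of (c, d) \<in> T.K"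
    using T.rel_b[of c d "e g"] a by (simp add: DR e_pdom[OF g] pdom_e[OF g])
  then have "0 - (frag_of (c \<otimes>\<^bsub>A\<^esub> d, e g) - frag_of (c, d)) \<in> T.K" by (rule T.K_diff[OF T.K_0])
  ultimately show ?case using a by simp
qed

lemma ev_act:
  assumes t: "Poly_Mapping.keys t \<subseteq> S" and q: "\<And>p. p \<in> S \<Longrightarrow> q p \<in> S \<and> bb (q p) = F (bb p)"
   and F: "\<And>c d. c \<in> C \<Longrightarrow> d \<in> C \<Longrightarrow> F (c \<ominus>\<^bsub>A\<^esub> d) = F c \<ominus>\<^bsub>A\<^esub> F d" and F0: "F \<zero>\<^bsub>A\<^esub> = \<zero>\<^bsub>A\<^esub>"
  shows "Poly_Mapping.keys (frag_extend (\<lambda>p. frag_of (q p)) t) \<subseteq> S \<and> frag_eval GB bb (frag_extend (\<lambda>p. frag_of (q p)) t) = F (frag_eval GB bb t)"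
  using t
proof (induction rule: free_Abelian_group_induct[consumes 1])
  case 1 then show ?case by (simp add: frag_eval_0[OF GB_ab] F0)
next
  case (2 x y)
  show ?case unfolding frag_extend_diff
    using 2 keys_diff[of "frag_extend (\<lambda>p. frag_of (q p)) x" "frag_extend (\<lambda>p. frag_of (q p)) y"]
    by (auto simp del: carr simp: ev_diff F ev_C)
next
  case (3 a)
  have qa: "q a \<in> S" "bb (q a) = F (bb a)" using q[OF 3] by blast+
  have "frag_eval GB bb (frag_of (q a)) = bb (q a)" by (rule frag_eval_of[where f = bb, OF GB_ab bb_C[OF qa(1)]])
  moreover have "frag_eval GB bb (frag_of a) = bb a" by (rule frag_eval_of[where f = bb, OF GB_ab bb_C[OF 3]])
  ultimately show ?case using qa by (simp del: carr)
qed

lemma class_Gamma: "bimodule_isomorphic R (tensor_product R CB TB) GB"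
  unfolding bimodule_isomorphic_def
proof (intro exI[of _ "tensor_lift GB b"] conjI ballI)
  let ?T = "tensor_product R CB TB"
  show "bij_betw (tensor_lift GB b) (carrier ?T) (carrier GB)"
  proof (rule bij_betwI')
    fix v w assume v: "v \<in> carrier ?T" and w: "w \<in> carrier ?T"
    obtain s where s: "Poly_Mapping.keys s \<subseteq> S" "v = T.cl s" using v by (rule T.carrier_cases)
    obtain t where t: "Poly_Mapping.keys t \<subseteq> S" "w = T.cl t" using w by (rule T.carrier_cases)
    show "tensor_lift GB b v = tensor_lift GB b w \<longleftrightarrow> v = w"
    proof
      assume "tensor_lift GB b v = tensor_lift GB b w"
      then have eq: "frag_eval GB bb s = frag_eval GB bb t" unfolding s(2) t(2) lift[OF s(1)] lift[OF t(1)] .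
      have "s - t \<in> T.K" using T.K_diff[OF ev_normal[OF s(1)] ev_normal[OF t(1)]] unfolding eq by simp
      then show "v = w" unfolding s(2) t(2) by (simp only: T.class_eq_iff)
    qed simp
  next
    fix w assume w: "w \<in> carrier ?T"
    obtain t where t: "Poly_Mapping.keys t \<subseteq> S" "w = T.cl t" using w by (rule T.carrier_cases)
    show "tensor_lift GB b w \<in> carrier GB" unfolding t(2) lift[OF t(1)] carr by (rule ev_C[OF t(1)])
  next
    fix c assume "c \<in> carrier GB"
    then have c: "c \<in> C" by simp
    have k: "Poly_Mapping.keys (frag_of (c, e g)) \<subseteq> S" using c e_pdom[OF g] by simp
    have "tensor_lift GB b (T.cl (frag_of (c, e g))) = c"
      unfolding lift[OF k] using frag_eval_of[OF GB_ab, of bb "(c, e g)"] c C_eg by simp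
    moreover have "T.cl (frag_of (c, e g)) \<in> carrier ?T"
      unfolding T.carrier_tensor using k by (intro imageI) simp
    ultimately show "\<exists>w\<in>carrier ?T. c = tensor_lift GB b w" by (metis (no_types))
  qed
next
  let ?T = "tensor_product R CB TB"
  fix v w assume v: "v \<in> carrier ?T" and w: "w \<in> carrier ?T"
  obtain s where s: "Poly_Mapping.keys s \<subseteq> S" "v = T.cl s" using v by (rule T.carrier_cases)
  obtain t where t: "Poly_Mapping.keys t \<subseteq> S" "w = T.cl t" using w by (rule T.carrier_cases)
  have st: "Poly_Mapping.keys (s + t) \<subseteq> S" using keys_add[of s t] s(1) t(1) by blast
  show "tensor_lift GB b (v \<oplus>\<^bsub>?T\<^esub> w) = tensor_lift GB b v \<oplus>\<^bsub>GB\<^esub> tensor_lift GB b w"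
    unfolding s(2) t(2) T.class_add[OF s(1) t(1)] lift[OF s(1)] lift[OF t(1)] lift[OF st]
    by (rule frag_eval_add[OF GB_ab bb_C s(1) t(1)])
next
  fix r w assume r: "r \<in> carrier R" and w: "w \<in> carrier (tensor_product R CB TB)"
  obtain t where t: "Poly_Mapping.keys t \<subseteq> S" "w = T.cl t" using w by (rule T.carrier_cases)
  let ?q = "\<lambda>(x, y). (r \<odot>\<^bsub>CB\<^esub> x, y)"
  have q: "(\<lambda>(x, y). frag_of (r \<odot>\<^bsub>CB\<^esub> x, y)) = (\<lambda>p. frag_of (?q p))" by auto
  have rel: "frag_extend (\<lambda>p. frag_of (?q p)) s \<in> T.K" if "s \<in> tensor_relations R CB TB" for s
    using that
  proof (rule T.rel_elim)
    fix x x' y assume "x \<in> carrier CB" "x' \<in> carrier CB" "y \<in> carrier TB"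
    then show "frag_extend (\<lambda>p. frag_of (?q p)) (frag_of (x \<oplus>\<^bsub>CB\<^esub> x', y) - frag_of (x, y) - frag_of (x', y)) \<in> T.K"
      using T.rel_l[of "x \<otimes>\<^bsub>A\<^esub> r" "x' \<otimes>\<^bsub>A\<^esub> r" y] r by (simp add: frag_extend_diff C_add C_mult C_tw A.l_distr C_A sub')
  next
    fix x y y' assume "x \<in> carrier CB" "y \<in> carrier TB" "y' \<in> carrier TB"
    then show "frag_extend (\<lambda>p. frag_of (?q p)) (frag_of (x, y \<oplus>\<^bsub>TB\<^esub> y') - frag_of (x, y) - frag_of (x, y')) \<in> T.K"
      using T.rel_r[of "x \<otimes>\<^bsub>A\<^esub> r" y y'] r by (simp add: frag_extend_diff C_mult C_tw)
  next
    fix x s y assume a: "x \<in> carrier CB" "s \<in> carrier R" "y \<in> carrier TB"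
    then have "x \<otimes>\<^bsub>A\<^esub> s \<otimes>\<^bsub>A\<^esub> r = x \<otimes>\<^bsub>A\<^esub> r \<otimes>\<^bsub>A\<^esub> s"
      using r by (simp add: A.m_assoc C_A sub' Rmult[symmetric] U.R.m_comm)
    then show "frag_extend (\<lambda>p. frag_of (?q p)) (frag_of (rsmult CB x s, y) - frag_of (x, s \<odot>\<^bsub>TB\<^esub> y)) \<in> T.K"
      using T.rel_b[of "x \<otimes>\<^bsub>A\<^esub> r" s y] a r by (simp add: frag_extend_diff C_mult C_tw)
  qed
  have E: "r \<odot>\<^bsub>tensor_product R CB TB\<^esub> w = T.cl (frag_extend (\<lambda>p. frag_of (?q p)) t)"
    unfolding t(2) tensor_acts q by (rule T.union_class[OF rel])
  have k: "Poly_Mapping.keys (frag_extend (\<lambda>p. frag_of (?q p)) t) \<subseteq> S \<and>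
    frag_eval GB bb (frag_extend (\<lambda>p. frag_of (?q p)) t) = frag_eval GB bb t \<otimes>\<^bsub>A\<^esub> r"
  proof (rule ev_act[OF t(1)])
    fix p assume "p \<in> S"
    then show "?q p \<in> S \<and> bb (?q p) = bb p \<otimes>\<^bsub>A\<^esub> r"
      using r by (auto simp: C_mult C_tw A.m_assoc C_A sub' DA DR Rmult[symmetric] U.R.m_comm)
  qed (use r in \<open>simp_all add: a_minus_def A.l_distr A.l_minus C_A sub'\<close>)
  show "tensor_lift GB b (r \<odot>\<^bsub>tensor_product R CB TB\<^esub> w) = r \<odot>\<^bsub>GB\<^esub> tensor_lift GB b w"
    by (subst E, subst lift[OF conjunct1[OF k]], subst t(2), subst lift[OF t(1)], subst carr(14), rule conjunct2[OF k])
next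
  fix r w assume r: "r \<in> carrier R" and w: "w \<in> carrier (tensor_product R CB TB)"
  obtain t where t: "Poly_Mapping.keys t \<subseteq> S" "w = T.cl t" using w by (rule T.carrier_cases)
  let ?q = "\<lambda>(x, y). (x, rsmult TB y r)"
  let ?a = "\<alpha> g (r \<otimes>\<^bsub>R\<^esub> e (inv\<^bsub>G\<^esub> g))"
  have aD: "?a \<in> pdom R e g" by (rule act_closed[OF g pdom_I[OF r]])
  have aR: "?a \<in> carrier R" using aD DR by blast
  have ca: "c \<otimes>\<^bsub>A\<^esub> ?a = r \<otimes>\<^bsub>A\<^esub> c" if c: "c \<in> C" for c
  proof -
    have "\<alpha> (inv\<^bsub>G\<^esub> g) ?a \<otimes>\<^bsub>A\<^esub> c = c \<otimes>\<^bsub>A\<^esub> ?a" using C_tw[OF c aR] pdom_e[OF g aD] by simp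
    moreover have "\<alpha> (inv\<^bsub>G\<^esub> g) ?a = r \<otimes>\<^bsub>R\<^esub> e (inv\<^bsub>G\<^esub> g)"
      using U.act_mult[OF ig g, of "r \<otimes>\<^bsub>R\<^esub> e (inv\<^bsub>G\<^esub> g)"] pdom_I[OF r] aD g
      by (simp add: U.act_one r U.idem_closed)
    ultimately show ?thesis using c r C_e by (simp add: Rmult U.idem_closed[OF ig] A.m_assoc sub' C_A)
  qed
  have q: "(\<lambda>(x, y). frag_of (x, rsmult TB y r)) = (\<lambda>p. frag_of (?q p))" by auto
  have rel: "frag_extend (\<lambda>p. frag_of (?q p)) s \<in> T.K" if "s \<in> tensor_relations R CB TB" for s
    using that
  proof (rule T.rel_elim)
    fix x x' y assume "x \<in> carrier CB" "x' \<in> carrier CB" "y \<in> carrier TB"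
    then show "frag_extend (\<lambda>p. frag_of (?q p)) (frag_of (x \<oplus>\<^bsub>CB\<^esub> x', y) - frag_of (x, y) - frag_of (x', y)) \<in> T.K"
      using T.rel_l[of "x" "x'" "y \<otimes>\<^bsub>R\<^esub> ?a"] aR by (simp add: frag_extend_diff pdom_mult'[OF g])
  next
    fix x y y' assume "x \<in> carrier CB" "y \<in> carrier TB" "y' \<in> carrier TB"
    then show "frag_extend (\<lambda>p. frag_of (?q p)) (frag_of (x, y \<oplus>\<^bsub>TB\<^esub> y') - frag_of (x, y) - frag_of (x, y')) \<in> T.K"
      using T.rel_r[of "x" "y \<otimes>\<^bsub>R\<^esub> ?a" "y' \<otimes>\<^bsub>R\<^esub> ?a"] aR by (simp add: frag_extend_diff pdom_mult'[OF g] U.R.l_distr DR)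
  next
    fix x s y assume a: "x \<in> carrier CB" "s \<in> carrier R" "y \<in> carrier TB"
    then show "frag_extend (\<lambda>p. frag_of (?q p)) (frag_of (rsmult CB x s, y) - frag_of (x, s \<odot>\<^bsub>TB\<^esub> y)) \<in> T.K"
      using T.rel_b[of "x" s "y \<otimes>\<^bsub>R\<^esub> ?a"] aR by (simp add: frag_extend_diff pdom_mult'[OF g] U.R.m_assoc DR)
  qed
  have E: "rsmult (tensor_product R CB TB) w r = T.cl (frag_extend (\<lambda>p. frag_of (?q p)) t)"
    unfolding t(2) tensor_acts q by (rule T.union_class[OF rel])
  have k: "Poly_Mapping.keys (frag_extend (\<lambda>p. frag_of (?q p)) t) \<subseteq> S \<and>
    frag_eval GB bb (frag_extend (\<lambda>p. frag_of (?q p)) t) = r \<otimes>\<^bsub>A\<^esub> frag_eval GB bb t"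
  proof (rule ev_act[OF t(1)])
    fix p assume "p \<in> S"
    then obtain c d where p: "p = (c, d)" "c \<in> C" "d \<in> pdom R e g" by auto
    have "c \<otimes>\<^bsub>A\<^esub> d \<otimes>\<^bsub>A\<^esub> ?a = r \<otimes>\<^bsub>A\<^esub> (c \<otimes>\<^bsub>A\<^esub> d)" using ca[OF C_mult[of c d]] p DR by simp
    then show "?q p \<in> S \<and> bb (?q p) = r \<otimes>\<^bsub>A\<^esub> bb p"
      using aR p pdom_mult'[OF g p(3) aR] by (simp add: Rmult DR A.m_assoc C_A DA sub')
  qed (use r in \<open>simp_all add: a_minus_def A.r_distr A.r_minus C_A sub'\<close>)
  show "tensor_lift GB b (rsmult (tensor_product R CB TB) w r) = rsmult GB (tensor_lift GB b w) r"
    by (subst E, subst lift[OF conjunct1[OF k]], subst t(2), subst lift[OF t(1)], subst carr(15), rule conjunct2[OF k])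
qed

end

theorem Gamma_class:
  assumes "unital_partial_action G R e \<alpha>" and "ring A" and "carrier R \<subseteq> carrier A"
    and "(\<lambda>x. x) \<in> ring_hom R A" and "g \<in> carrier G"
  shows "bimodule_isomorphic R
    (tensor_product R (cocycle_bimodule G R e \<alpha> A g) (Theta_bimodule G R e \<alpha> g))
    (Gamma_bimodule G R e \<alpha> A g)"
  by (rule contained_partial_action_at.class_Gamma[OF contained_partial_action_at.intro,
    OF contained_partial_action.intro contained_partial_action_at_axioms.intro, OF assms])

end

(* Put b_g(r) = alpha_g(r 1_{g^-1}) and let x_i, y_i be Galois coordinates. The additive map
   pi_g(a) = \<Sum>_i b_{g^-1}(x_i) a y_i is the projection of A onto C_g: the identity
   r x_j = \<Sum>_i x_i tr(y_i r x_j), its mirror image for the y_j, and the centrality of traces in A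
   give pi_g(A) \<subseteq> C_g; the sum of all pi_g(a) is a \<Sum>_i tr(x_i) y_i = a; and on C_h the
   Galois equations make pi_g the identity or zero. So A is the internal direct sum of the C_g,
   and summing components is the isomorphism from Delta(Gamma) onto the opposite of A. *)
theory Submission
  imports Defs
begin

text \<open>The formula for \<open>proj\<close> comes from viewing A as a module over R \<otimes> R
  (tensor over the invariants) by (b \<otimes> c)a = bac. Under r \<otimes> s |-> (r b_h(s))_h, with
  values in the product of the D_h, the tensor Sum_i b_{g^-1}(x_i) \<otimes> y_i goes to the family
  that is 1_{g^-1} at g^-1 and 0 elsewhere; this is \<open>galois_conj\<close>. An element a of C_g
  satisfies as = b_{g^-1}(s)a, so R \<otimes> R acts on it through the coordinate g^-1, and
  \<open>proj g\<close> is the action of that idempotent. Partiality is the obstacle: b_g b_h is in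
  general not b_{gh} but b_{gh} times 1_g, and b_g sends 1 to 1_g. Each composition leaves an
  idempotent behind that some neighbouring factor has to absorb. The algebra axioms of Delta(Gamma)
  are not verified on the convolution product. They are pulled back from the opposite of A along the
  summing map, so that only the values of the factor set on pure tensors have to be
  computed.\<close>

section \<open>Finite sums, transport of algebra structure, opposite algebras\<close>

text \<open>Infinite S is included because both sums then default to zero. The map h is merely
  additive, as it will be the non-unital \<open>gact g\<close>, an inclusion into A, or
  \<open>proj h\<close>.\<close>

lemma finsum_hom:
  assumes "abelian_monoid M" "abelian_monoid N"
    and "h \<in> carrier M \<rightarrow> carrier N" "h \<zero>\<^bsub>M\<^esub> = \<zero>\<^bsub>N\<^esub>"
    and "\<And>x y. \<lbrakk>x \<in> carrier M; y \<in> carrier M\<rbrakk> \<Longrightarrow> h (x \<oplus>\<^bsub>M\<^esub> y) = h x \<oplus>\<^bsub>N\<^esub> h y"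
    and "f \<in> S \<rightarrow> carrier M"
  shows "h (finsum M f S) = finsum N (\<lambda>i. h (f i)) S"
proof -
  interpret M: abelian_monoid M by fact
  interpret N: abelian_monoid N by fact
  show ?thesis using assms(6)
  proof (induction S rule: infinite_finite_induct)
    case (insert i S)
    then have "h (f i) \<in> carrier N" "(\<lambda>i. h (f i)) \<in> S \<rightarrow> carrier N" using assms(3) by auto
    with insert show ?case by (simp add: M.finsum_insert N.finsum_insert assms(5) Pi_def M.finsum_closed)
  qed (simp_all add: assms(4))
qed

lemma (in abelian_monoid) finsum_swap:
  assumes "finite S" "finite T" "\<And>i j. \<lbrakk>i \<in> S; j \<in> T\<rbrakk> \<Longrightarrow> f i j \<in> carrier G"
  shows "(\<Oplus>i\<in>S. \<Oplus>j\<in>T. f i j) = (\<Oplus>j\<in>T. \<Oplus>i\<in>S. f i j)"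
  using assms(1,3)
proof (induction S)
  case (insert i S)
  then have "(\<Oplus>i\<in>insert i S. \<Oplus>j\<in>T. f i j) = (\<Oplus>j\<in>T. f i j) \<oplus> (\<Oplus>i\<in>S. \<Oplus>j\<in>T. f i j)"
    by (intro finsum_insert) (auto intro!: finsum_closed)
  also have "\<dots> = (\<Oplus>j\<in>T. f i j \<oplus> (\<Oplus>i\<in>S. f i j))"
    using insert by (subst finsum_addf) (auto intro!: finsum_closed)
  also have "\<dots> = (\<Oplus>j\<in>T. \<Oplus>i\<in>insert i S. f i j)"
    using insert by (intro finsum_cong' refl) (auto simp: finsum_insert Pi_def intro!: finsum_closed)
  finally show ?case .
qed simp

text \<open>Injectivity of \<phi> reflects every equational axiom from C to B. The one existential
  axiom, additive inverses, uses surjectivity: the negative of u is a preimage of the negative of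
  \<phi> u.\<close>

lemma k_algebra_transport:
  fixes B :: "('k, 'b, 'z) module_scheme" and C :: "('k, 'c, 'w) module_scheme"
  assumes C: "k_algebra k C" and bij: "bij_betw \<phi> (carrier B) (carrier C)"
    and one: "\<one>\<^bsub>B\<^esub> \<in> carrier B" "\<phi> \<one>\<^bsub>B\<^esub> = \<one>\<^bsub>C\<^esub>" and zero: "\<zero>\<^bsub>B\<^esub> \<in> carrier B" "\<phi> \<zero>\<^bsub>B\<^esub> = \<zero>\<^bsub>C\<^esub>"
    and add: "\<And>u v. \<lbrakk>u \<in> carrier B; v \<in> carrier B\<rbrakk> \<Longrightarrow> u \<oplus>\<^bsub>B\<^esub> v \<in> carrier B \<and> \<phi> (u \<oplus>\<^bsub>B\<^esub> v) = \<phi> u \<oplus>\<^bsub>C\<^esub> \<phi> v"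
    and mult: "\<And>u v. \<lbrakk>u \<in> carrier B; v \<in> carrier B\<rbrakk> \<Longrightarrow> u \<otimes>\<^bsub>B\<^esub> v \<in> carrier B \<and> \<phi> (u \<otimes>\<^bsub>B\<^esub> v) = \<phi> u \<otimes>\<^bsub>C\<^esub> \<phi> v"
    and smult: "\<And>s u. \<lbrakk>s \<in> carrier k; u \<in> carrier B\<rbrakk> \<Longrightarrow> s \<odot>\<^bsub>B\<^esub> u \<in> carrier B \<and> \<phi> (s \<odot>\<^bsub>B\<^esub> u) = s \<odot>\<^bsub>C\<^esub> \<phi> u"
  shows "k_algebra k B"
proof -
  interpret C: k_algebra k C by fact
  note [simp] = one zero add[THEN conjunct1] add[THEN conjunct2] mult[THEN conjunct1] mult[THEN conjunct2]
    smult[THEN conjunct1] smult[THEN conjunct2]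
  have c [simp]: "u \<in> carrier B \<Longrightarrow> \<phi> u \<in> carrier C" for u
    using bij by (auto simp: bij_betw_def)
  have eq: "u = v" if "\<phi> u = \<phi> v" "u \<in> carrier B" "v \<in> carrier B" for u v
    using bij that by (auto simp: bij_betw_def dest: inj_onD)
  have neg: "\<exists>v\<in>carrier B. v \<oplus>\<^bsub>B\<^esub> u = \<zero>\<^bsub>B\<^esub>" if u: "u \<in> carrier B" for u
  proof -
    have "\<ominus>\<^bsub>C\<^esub> \<phi> u \<in> \<phi> ` carrier B" using bij u by (auto simp: bij_betw_def)
    then obtain v where v: "v \<in> carrier B" "\<phi> v = \<ominus>\<^bsub>C\<^esub> \<phi> u" by force
    then show ?thesis using u by (intro bexI[of _ v] eq) (simp_all add: C.l_neg)
  qed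
  have ab: "abelian_group B"
    by (rule abelian_groupI) (auto simp: neg C.a_assoc C.add.m_lcomm C.a_comm intro!: eq)
  have "monoid B"
    by (rule monoidI) (auto simp: C.m_assoc intro!: eq)
  then have ring: "ring B"
    by (rule ringI[OF ab]) (auto simp: C.l_distr C.r_distr intro!: eq)
  have "module k B"
    by (rule moduleI[OF _ ab])
      (auto simp: C.smult_l_distr C.smult_r_distr C.smult_assoc1 C.R.cring_axioms intro!: eq)
  then show ?thesis
    by (rule k_algebra.intro[OF _ ring], unfold_locales)
      (auto simp: C.smult_mult_left C.smult_mult_right intro!: eq)
qed

lemma opposite_sel [simp]:
  "carrier (opposite A) = carrier A" "x \<otimes>\<^bsub>opposite A\<^esub> y = y \<otimes>\<^bsub>A\<^esub> x" "\<one>\<^bsub>opposite A\<^esub> = \<one>\<^bsub>A\<^esub>"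
  "\<zero>\<^bsub>opposite A\<^esub> = \<zero>\<^bsub>A\<^esub>" "add (opposite A) = add A" "smult (opposite A) = smult A"
  by (simp_all add: opposite_def)

lemma k_algebra_opposite:
  assumes "k_algebra k A"
  shows "k_algebra k (opposite A)"
proof -
  interpret k_algebra k A by fact
  have ab: "abelian_group (opposite A)"
    by (rule abelian_groupI) (auto simp: a_assoc a_comm add.m_lcomm intro: M.add.l_inv_ex)
  have "monoid (opposite A)" by (rule monoidI) (auto simp: m_assoc)
  then have ring: "ring (opposite A)" by (rule ringI[OF ab]) (auto simp: l_distr r_distr)
  have "module k (opposite A)"
    by (rule moduleI[OF _ ab])
      (auto simp: smult_l_distr smult_r_distr smult_assoc1 R.cring_axioms)
  then show ?thesis
    by (rule k_algebra.intro[OF _ ring], unfold_locales)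
      (auto simp: smult_mult_left smult_mult_right)
qed

section \<open>The partial action extended to maps on all of R\<close>

context unital_partial_action
begin

text \<open>The map b_g of the overview. The axioms constrain \<open>\<alpha> g\<close> on D_{g^-1}
  alone; cutting down by 1_{g^-1} first gives an additive and multiplicative map on all of R that
  can be composed and summed freely.\<close>

definition gact :: "'g \<Rightarrow> 'a \<Rightarrow> 'a"
  where "gact g r = \<alpha> g (r \<otimes>\<^bsub>R\<^esub> e (inv\<^bsub>G\<^esub> g))"

lemma pdom_iff:
  assumes "g \<in> carrier G"
  shows "x \<in> pdom R e g \<longleftrightarrow> x \<in> carrier R \<and> x \<otimes>\<^bsub>R\<^esub> e g = x"
  using idem_closed[OF assms] idem[OF assms]
  by (auto simp: pdom_def cgenideal_def R.m_assoc intro: exI[of _ x])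

lemma mult_e_pdom: "\<lbrakk>g \<in> carrier G; r \<in> carrier R\<rbrakk> \<Longrightarrow> r \<otimes>\<^bsub>R\<^esub> e g \<in> pdom R e g"
  by (simp add: pdom_iff R.m_assoc idem idem_closed)

lemma e_one: "e \<one>\<^bsub>G\<^esub> = \<one>\<^bsub>R\<^esub>"
  using pdom_iff[of "\<one>\<^bsub>G\<^esub>" "\<one>\<^bsub>R\<^esub>"] idem_closed[of "\<one>\<^bsub>G\<^esub>"] by (simp add: dom_one)

lemma act_hom:
  assumes "g \<in> carrier G"
  shows "x \<in> pdom R e (inv\<^bsub>G\<^esub> g) \<Longrightarrow> \<alpha> g x \<in> pdom R e g"
    and "\<lbrakk>x \<in> pdom R e (inv\<^bsub>G\<^esub> g); y \<in> pdom R e (inv\<^bsub>G\<^esub> g)\<rbrakk> \<Longrightarrow> \<alpha> g (x \<otimes>\<^bsub>R\<^esub> y) = \<alpha> g x \<otimes>\<^bsub>R\<^esub> \<alpha> g y"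
    and "\<lbrakk>x \<in> pdom R e (inv\<^bsub>G\<^esub> g); y \<in> pdom R e (inv\<^bsub>G\<^esub> g)\<rbrakk> \<Longrightarrow> \<alpha> g (x \<oplus>\<^bsub>R\<^esub> y) = \<alpha> g x \<oplus>\<^bsub>R\<^esub> \<alpha> g y"
    and "\<alpha> g (e (inv\<^bsub>G\<^esub> g)) = e g"
  using iso[OF assms] by (auto simp: ring_iso_def ring_hom_def pdom_ring_def)

lemma gact_pdom: "\<lbrakk>g \<in> carrier G; r \<in> carrier R\<rbrakk> \<Longrightarrow> gact g r \<in> pdom R e g"
  unfolding gact_def by (rule act_hom(1)) (simp_all add: mult_e_pdom)

lemma gact_closed [simp]: "\<lbrakk>g \<in> carrier G; r \<in> carrier R\<rbrakk> \<Longrightarrow> gact g r \<in> carrier R"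
  using gact_pdom pdom_iff by blast

lemma gact_e: "\<lbrakk>g \<in> carrier G; r \<in> carrier R\<rbrakk> \<Longrightarrow> gact g r \<otimes>\<^bsub>R\<^esub> e g = gact g r"
  using gact_pdom pdom_iff by blast

lemma gact_add:
  assumes "g \<in> carrier G" "r \<in> carrier R" "s \<in> carrier R"
  shows "gact g (r \<oplus>\<^bsub>R\<^esub> s) = gact g r \<oplus>\<^bsub>R\<^esub> gact g s"
  using assms by (simp add: gact_def R.l_distr idem_closed act_hom(3) mult_e_pdom)

lemma gact_mult:
  assumes "g \<in> carrier G" "r \<in> carrier R" "s \<in> carrier R"
  shows "gact g (r \<otimes>\<^bsub>R\<^esub> s) = gact g r \<otimes>\<^bsub>R\<^esub> gact g s"
proof -
  have E: "e (inv\<^bsub>G\<^esub> g) \<in> carrier R" "e (inv\<^bsub>G\<^esub> g) \<otimes>\<^bsub>R\<^esub> e (inv\<^bsub>G\<^esub> g) = e (inv\<^bsub>G\<^esub> g)"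
    using assms by (simp_all add: idem idem_closed)
  have "r \<otimes>\<^bsub>R\<^esub> s \<otimes>\<^bsub>R\<^esub> e (inv\<^bsub>G\<^esub> g) = r \<otimes>\<^bsub>R\<^esub> s \<otimes>\<^bsub>R\<^esub> (e (inv\<^bsub>G\<^esub> g) \<otimes>\<^bsub>R\<^esub> e (inv\<^bsub>G\<^esub> g))"
    by (simp only: E(2))
  also have "\<dots> = (r \<otimes>\<^bsub>R\<^esub> e (inv\<^bsub>G\<^esub> g)) \<otimes>\<^bsub>R\<^esub> (s \<otimes>\<^bsub>R\<^esub> e (inv\<^bsub>G\<^esub> g))"
    using E(1) assms by (simp add: R.m_ac)
  finally show ?thesis using assms by (simp add: gact_def act_hom(2) mult_e_pdom)
qed

lemma gact_group_one [simp]: "r \<in> carrier R \<Longrightarrow> gact \<one>\<^bsub>G\<^esub> r = r"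
  by (simp add: gact_def e_one act_one)

lemma gact_ring_one: "g \<in> carrier G \<Longrightarrow> gact g \<one>\<^bsub>R\<^esub> = e g"
  by (simp add: gact_def idem_closed act_hom(4))

lemma gact_zero: "g \<in> carrier G \<Longrightarrow> gact g \<zero>\<^bsub>R\<^esub> = \<zero>\<^bsub>R\<^esub>"
  using gact_add[of g "\<zero>\<^bsub>R\<^esub>" "\<zero>\<^bsub>R\<^esub>"] R.add.l_cancel_one[of "gact g \<zero>\<^bsub>R\<^esub>" "gact g \<zero>\<^bsub>R\<^esub>"] by simp

lemma gact_finsum:
  "\<lbrakk>g \<in> carrier G; f \<in> S \<rightarrow> carrier R\<rbrakk> \<Longrightarrow> gact g (finsum R f S) = finsum R (\<lambda>i. gact g (f i)) S"
  by (rule finsum_hom[where f = f]) (auto simp: gact_zero gact_add R.abelian_monoid_axioms)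

lemma act_inv:
  assumes "g \<in> carrier G" "x \<in> pdom R e (inv\<^bsub>G\<^esub> g)"
  shows "\<alpha> (inv\<^bsub>G\<^esub> g) (\<alpha> g x) = x"
  using act_mult[of "inv\<^bsub>G\<^esub> g" g x] act_hom(1)[OF assms] assms by (simp add: act_one pdom_iff)

lemma act_inv':
  assumes "g \<in> carrier G" "x \<in> pdom R e g"
  shows "\<alpha> g (\<alpha> (inv\<^bsub>G\<^esub> g) x) = x"
  using act_inv[of "inv\<^bsub>G\<^esub> g" x] assms by simp

text \<open>The axiom \<open>act_dom\<close> gives only an inclusion of ideals, namely that
  \<alpha>_{g^-1} maps D_g \<inter> D_{h^-1} into D_{g^-1} \<inter> D_{(hg)^-1}. The same inclusion
  for the inverse map makes it an equality, and a ring isomorphism carries unit to unit.\<close>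

lemma act_inv_e:
  assumes g: "g \<in> carrier G" and h: "h \<in> carrier G"
  shows "\<alpha> (inv\<^bsub>G\<^esub> g) (e (inv\<^bsub>G\<^esub> h) \<otimes>\<^bsub>R\<^esub> e g) = e (inv\<^bsub>G\<^esub> g) \<otimes>\<^bsub>R\<^esub> e (inv\<^bsub>G\<^esub> (h \<otimes>\<^bsub>G\<^esub> g))"
proof -
  \<comment> \<open>Stated for arbitrary g and h because it is used twice: at (g, h), and at (g^-1,
    hg) for the inverse map.\<close>
  have sub: "\<alpha> (inv\<^bsub>G\<^esub> g) (e (inv\<^bsub>G\<^esub> h) \<otimes>\<^bsub>R\<^esub> e g) \<in> pdom R e (inv\<^bsub>G\<^esub> g) \<inter> pdom R e (inv\<^bsub>G\<^esub> (h \<otimes>\<^bsub>G\<^esub> g))"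
    if g: "g \<in> carrier G" and h: "h \<in> carrier G" for g h
  proof -
    let ?x = "e (inv\<^bsub>G\<^esub> h) \<otimes>\<^bsub>R\<^esub> e g"
    have x: "?x \<in> pdom R e g" "?x \<in> pdom R e (inv\<^bsub>G\<^esub> h)"
      using mult_e_pdom[of g "e (inv\<^bsub>G\<^esub> h)"] mult_e_pdom[of "inv\<^bsub>G\<^esub> h" "e g"] g h
      by (simp_all add: idem_closed R.m_comm)
    have i: "\<alpha> (inv\<^bsub>G\<^esub> g) ?x \<in> pdom R e (inv\<^bsub>G\<^esub> g)" using act_hom(1)[of "inv\<^bsub>G\<^esub> g" ?x] x g by simp
    then have "\<alpha> (inv\<^bsub>G\<^esub> g) ?x \<in> pdom R e (inv\<^bsub>G\<^esub> (h \<otimes>\<^bsub>G\<^esub> g))"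
      using act_inv'[OF g x(1)] x g h by (intro act_dom) auto
    with i show ?thesis by blast
  qed
  let ?p = "e (inv\<^bsub>G\<^esub> g)" and ?q = "e (inv\<^bsub>G\<^esub> (h \<otimes>\<^bsub>G\<^esub> g))"
  let ?E = "\<alpha> (inv\<^bsub>G\<^esub> g) (e (inv\<^bsub>G\<^esub> h) \<otimes>\<^bsub>R\<^esub> e g)" and ?F = "\<alpha> g (?q \<otimes>\<^bsub>R\<^esub> ?p)"
  have cl: "?p \<in> carrier R" "?q \<in> carrier R" "e g \<in> carrier R" "e (inv\<^bsub>G\<^esub> h) \<in> carrier R"
    using g h by (simp_all add: idem_closed)
  have E: "?E \<in> carrier R" "?E \<otimes>\<^bsub>R\<^esub> ?p = ?E" "?E \<otimes>\<^bsub>R\<^esub> ?q = ?E"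
    using sub[OF g h] g h by (simp_all add: pdom_iff)
  have F: "?F \<in> pdom R e g" "?F \<in> pdom R e (inv\<^bsub>G\<^esub> h)"
    using sub[of "inv\<^bsub>G\<^esub> g" "h \<otimes>\<^bsub>G\<^esub> g"] g h by (simp_all add: G.m_assoc)
  have "?q \<otimes>\<^bsub>R\<^esub> ?p = \<alpha> (inv\<^bsub>G\<^esub> g) ?F"
    using act_inv[OF g mult_e_pdom[of "inv\<^bsub>G\<^esub> g" ?q]] g cl by simp
  \<comment> \<open>\<open>?F\<close> lies in the ideal with unit 1_{h^-1}1_g. Inserting this unit
    and mapping back turns \<open>?q\<close> times \<open>?p\<close> into its own product with
    \<open>?E\<close>, while \<open>?E\<close> absorbs both idempotents.\<close>
  also have "?F = ?F \<otimes>\<^bsub>R\<^esub> (e (inv\<^bsub>G\<^esub> h) \<otimes>\<^bsub>R\<^esub> e g)"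
    using F g h cl by (simp add: pdom_iff R.m_assoc[symmetric])
  also have "\<alpha> (inv\<^bsub>G\<^esub> g) \<dots> = \<alpha> (inv\<^bsub>G\<^esub> g) ?F \<otimes>\<^bsub>R\<^esub> ?E"
    using F(1) g cl by (intro act_hom(2)) (simp_all add: mult_e_pdom)
  also have "\<alpha> (inv\<^bsub>G\<^esub> g) ?F = ?q \<otimes>\<^bsub>R\<^esub> ?p"
    using act_inv[OF g mult_e_pdom[of "inv\<^bsub>G\<^esub> g" ?q]] g cl by simp
  also have "?q \<otimes>\<^bsub>R\<^esub> ?p \<otimes>\<^bsub>R\<^esub> ?E = ?E"
    using E cl by (metis R.m_assoc R.m_comm)
  finally show ?thesis using cl by (simp add: R.m_comm)
qed

text \<open>The replacement for the composition law of a global action; the factor 1_g is the trace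
  of partiality that all later computations have to absorb.\<close>

lemma gact_gact:
  assumes g: "g \<in> carrier G" and h: "h \<in> carrier G" and r: "r \<in> carrier R"
  shows "gact g (gact h r) = gact (g \<otimes>\<^bsub>G\<^esub> h) r \<otimes>\<^bsub>R\<^esub> e g"
proof -
  let ?p = "e (inv\<^bsub>G\<^esub> h)" and ?q = "e (inv\<^bsub>G\<^esub> (g \<otimes>\<^bsub>G\<^esub> h))" and ?E = "e (inv\<^bsub>G\<^esub> g) \<otimes>\<^bsub>R\<^esub> e h"
  have cl: "?p \<in> carrier R" "?q \<in> carrier R" "e g \<in> carrier R" "e h \<in> carrier R" "e (inv\<^bsub>G\<^esub> g) \<in> carrier R" "e (g \<otimes>\<^bsub>G\<^esub> h) \<in> carrier R"
    using g h by (simp_all add: idem_closed)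
  \<comment> \<open>This is r cut down to D_{h^-1} \<inter> D_{(gh)^-1}, where
    \<open>act_mult\<close> applies. The idempotent \<open>?p\<close> is doubled so that both
    factors lie in D_{h^-1} and \<alpha>_h can be taken factor by factor.\<close>
  define w where "w = r \<otimes>\<^bsub>R\<^esub> ?p \<otimes>\<^bsub>R\<^esub> (?p \<otimes>\<^bsub>R\<^esub> ?q)"
  have pq: "?p \<otimes>\<^bsub>R\<^esub> ?q \<in> pdom R e (inv\<^bsub>G\<^esub> h)" "?p \<otimes>\<^bsub>R\<^esub> ?q \<in> pdom R e (inv\<^bsub>G\<^esub> (g \<otimes>\<^bsub>G\<^esub> h))"
    using mult_e_pdom[of "inv\<^bsub>G\<^esub> h" ?q] mult_e_pdom[of "inv\<^bsub>G\<^esub> (g \<otimes>\<^bsub>G\<^esub> h)" ?p] g h cl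
    by (simp_all add: R.m_comm)
  have w: "w \<in> pdom R e (inv\<^bsub>G\<^esub> h)" "w = r \<otimes>\<^bsub>R\<^esub> ?p \<otimes>\<^bsub>R\<^esub> ?q"
    using pq g h r cl idem[of "inv\<^bsub>G\<^esub> h"] unfolding w_def
    by (simp_all add: pdom_iff R.m_assoc) (metis R.m_assoc cl)
  have "\<alpha> h (?p \<otimes>\<^bsub>R\<^esub> ?q) = ?E \<otimes>\<^bsub>R\<^esub> \<one>\<^bsub>R\<^esub>"
    using act_inv'[OF h mult_e_pdom[OF h cl(5)]] act_inv_e[OF h g] cl by simp
  then have aw: "\<alpha> h w = gact h r \<otimes>\<^bsub>R\<^esub> ?E"
    unfolding w_def gact_def using pq(1) h r cl by (subst act_hom(2)) (simp_all add: mult_e_pdom)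
  also have "\<dots> = gact h r \<otimes>\<^bsub>R\<^esub> e (inv\<^bsub>G\<^esub> g)"
    using gact_e[OF h r] cl h r by (metis R.m_assoc R.m_comm gact_closed)
  finally have aw: "\<alpha> h w = gact h r \<otimes>\<^bsub>R\<^esub> e (inv\<^bsub>G\<^esub> g)" .
  have "\<alpha> h w \<in> pdom R e (inv\<^bsub>G\<^esub> g)" unfolding aw using g h r by (simp add: mult_e_pdom)
  then have "gact g (gact h r) = \<alpha> (g \<otimes>\<^bsub>G\<^esub> h) w"
    unfolding gact_def[of g] aw[symmetric] using act_hom(1)[OF h w(1)] g h w(1) by (intro act_mult) auto
  also have "\<dots> = gact (g \<otimes>\<^bsub>G\<^esub> h) r \<otimes>\<^bsub>R\<^esub> gact (g \<otimes>\<^bsub>G\<^esub> h) ?p"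
    unfolding w(2) using g h r cl by (simp add: gact_mult[symmetric]) (simp add: gact_def)
  \<comment> \<open>The instance of \<open>act_inv_e\<close> at (gh)^-1 and h, where h(gh)^-1
    collapses to g^-1.\<close>
  also have "gact (g \<otimes>\<^bsub>G\<^esub> h) ?p = e (g \<otimes>\<^bsub>G\<^esub> h) \<otimes>\<^bsub>R\<^esub> e g"
    using act_inv_e[of "inv\<^bsub>G\<^esub> (g \<otimes>\<^bsub>G\<^esub> h)" h] g h by (simp add: gact_def G.inv_mult_group G.m_assoc[symmetric])
  also have "gact (g \<otimes>\<^bsub>G\<^esub> h) r \<otimes>\<^bsub>R\<^esub> (e (g \<otimes>\<^bsub>G\<^esub> h) \<otimes>\<^bsub>R\<^esub> e g) = gact (g \<otimes>\<^bsub>G\<^esub> h) r \<otimes>\<^bsub>R\<^esub> e g"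
    using gact_e[of "g \<otimes>\<^bsub>G\<^esub> h" r] g h r cl by (simp add: R.m_assoc[symmetric])
  finally show ?thesis .
qed

section \<open>Invariants and the partial trace\<close>

abbreviation (input) "k \<equiv> invariants G R e \<alpha>"

lemma invariants_iff:
  "t \<in> carrier k \<longleftrightarrow> t \<in> carrier R \<and> (\<forall>g\<in>carrier G. gact g t = t \<otimes>\<^bsub>R\<^esub> e g)"
  by (simp add: invariants_def gact_def)

definition trace :: "'a \<Rightarrow> 'a"
  where "trace r = (\<Oplus>\<^bsub>R\<^esub>g\<in>carrier G. gact g r)"

lemma trace_closed [simp]: "r \<in> carrier R \<Longrightarrow> trace r \<in> carrier R"
  unfolding trace_def by (rule R.finsum_closed) simp

text \<open>By \<open>gact_gact\<close>, applying b_h turns the summand at g into the summand at hg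
  times 1_h. The idempotent is the same for all g and factors out; left translation by h permutes
  the rest.\<close>

lemma trace_invariant:
  assumes fin: "finite (carrier G)" and r: "r \<in> carrier R"
  shows "trace r \<in> carrier k"
proof -
  have "gact h (trace r) = trace r \<otimes>\<^bsub>R\<^esub> e h" if h: "h \<in> carrier G" for h
  proof -
    have "gact h (trace r) = (\<Oplus>\<^bsub>R\<^esub>g\<in>carrier G. gact (h \<otimes>\<^bsub>G\<^esub> g) r \<otimes>\<^bsub>R\<^esub> e h)"
      unfolding trace_def using h r
      by (subst gact_finsum) (auto intro!: R.finsum_cong' simp: gact_gact idem_closed)
    also have "\<dots> = (\<Oplus>\<^bsub>R\<^esub>g\<in>(\<lambda>g. h \<otimes>\<^bsub>G\<^esub> g) ` carrier G. gact g r \<otimes>\<^bsub>R\<^esub> e h)"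
      using h r by (intro R.finsum_reindex[symmetric]) (auto simp: idem_closed G.inj_on_cmult)
    also have "(\<lambda>g. h \<otimes>\<^bsub>G\<^esub> g) ` carrier G = carrier G" by (rule G.surj_const_mult[OF h])
    also have "(\<Oplus>\<^bsub>R\<^esub>g\<in>carrier G. gact g r \<otimes>\<^bsub>R\<^esub> e h) = trace r \<otimes>\<^bsub>R\<^esub> e h"
      unfolding trace_def using h r fin by (intro R.finsum_ldistr[symmetric]) (auto simp: idem_closed)
    finally show ?thesis .
  qed
  then show ?thesis using r by (simp add: invariants_iff)
qed

text \<open>Linearity of b_g over the invariants: b_g(t) is t1_g rather than t, but b_g(r) already
  absorbs 1_g.\<close>

lemma gact_invariant_mult:
  assumes "g \<in> carrier G" "r \<in> carrier R" "t \<in> carrier k"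
  shows "gact g (r \<otimes>\<^bsub>R\<^esub> t) = gact g r \<otimes>\<^bsub>R\<^esub> t"
proof -
  have t: "t \<in> carrier R" "gact g t = t \<otimes>\<^bsub>R\<^esub> e g" using assms by (simp_all add: invariants_iff)
  have "gact g r \<otimes>\<^bsub>R\<^esub> (t \<otimes>\<^bsub>R\<^esub> e g) = gact g r \<otimes>\<^bsub>R\<^esub> e g \<otimes>\<^bsub>R\<^esub> t"
    using assms t by (simp add: idem_closed R.m_ac)
  then show ?thesis using assms t by (simp add: gact_mult gact_e)
qed

end

section \<open>Galois coordinates and trace expansions\<close>

locale partial_galois = unital_partial_action G R e \<alpha>
  for G :: "('g, 'n) monoid_scheme" and R :: "('a, 'm) ring_scheme"
    and e :: "'g \<Rightarrow> 'a" and \<alpha> :: "'g \<Rightarrow> 'a \<Rightarrow> 'a" +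
  fixes I :: "nat set" and x y :: "nat \<Rightarrow> 'a"
  assumes fin: "finite (carrier G)" and fin_I: "finite I"
    and x: "x \<in> I \<rightarrow> carrier R" and y: "y \<in> I \<rightarrow> carrier R"
    and galois: "g \<in> carrier G \<Longrightarrow>
      (\<Oplus>\<^bsub>R\<^esub>i\<in>I. x i \<otimes>\<^bsub>R\<^esub> gact g (y i)) = (if g = \<one>\<^bsub>G\<^esub> then \<one>\<^bsub>R\<^esub> else \<zero>\<^bsub>R\<^esub>)"
begin

lemma x_closed [simp]: "i \<in> I \<Longrightarrow> x i \<in> carrier R" using x by auto
lemma y_closed [simp]: "i \<in> I \<Longrightarrow> y i \<in> carrier R" using y by auto

text \<open>Apply b_g to the Galois equation of g^-1h: by \<open>gact_gact\<close> the second factor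
  becomes b_h(y_i)1_g, and b_g(x_i) absorbs the idempotent. The case h = 1 shifts the action from
  the y_i to the x_i.\<close>

lemma galois_conj:
  assumes g: "g \<in> carrier G" and h: "h \<in> carrier G"
  shows "(\<Oplus>\<^bsub>R\<^esub>i\<in>I. gact g (x i) \<otimes>\<^bsub>R\<^esub> gact h (y i)) = (if g = h then e g else \<zero>\<^bsub>R\<^esub>)"
proof -
  let ?j = "inv\<^bsub>G\<^esub> g \<otimes>\<^bsub>G\<^esub> h"
  have j: "?j \<in> carrier G" "?j = \<one>\<^bsub>G\<^esub> \<longleftrightarrow> g = h" "g \<otimes>\<^bsub>G\<^esub> ?j = h"
    using g h by (auto simp: G.m_assoc[symmetric]) (metis G.inv_equality G.inv_inv G.inv_closed)
  have "gact g (x i \<otimes>\<^bsub>R\<^esub> gact ?j (y i)) = gact g (x i) \<otimes>\<^bsub>R\<^esub> gact h (y i)" if i: "i \<in> I" for i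
  proof -
    have "gact g (x i \<otimes>\<^bsub>R\<^esub> gact ?j (y i)) = gact g (x i) \<otimes>\<^bsub>R\<^esub> (gact h (y i) \<otimes>\<^bsub>R\<^esub> e g)"
      using i g h j(1) gact_gact[OF g j(1), of "y i"] by (simp only: j(3) gact_mult x_closed y_closed gact_closed)
    also have "\<dots> = gact g (x i) \<otimes>\<^bsub>R\<^esub> e g \<otimes>\<^bsub>R\<^esub> gact h (y i)"
      using i g h by (simp add: R.m_ac idem_closed)
    finally show ?thesis using i g by (simp add: gact_e)
  qed
  then have "(\<Oplus>\<^bsub>R\<^esub>i\<in>I. gact g (x i) \<otimes>\<^bsub>R\<^esub> gact h (y i)) = gact g (\<Oplus>\<^bsub>R\<^esub>i\<in>I. x i \<otimes>\<^bsub>R\<^esub> gact ?j (y i))"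
    using g h j(1) by (subst gact_finsum) (auto intro!: R.finsum_cong')
  then show ?thesis using galois[OF j(1)] g h by (cases "g = h") (simp_all add: j(2) gact_ring_one gact_zero)
qed

text \<open>After the sums are exchanged, the coefficient of b_g(s) is Sum_i b_g(x_i)y_i, which
  vanishes unless g = 1.\<close>

lemma trace_expansion_y:
  assumes s: "s \<in> carrier R"
  shows "(\<Oplus>\<^bsub>R\<^esub>i\<in>I. trace (s \<otimes>\<^bsub>R\<^esub> x i) \<otimes>\<^bsub>R\<^esub> y i) = s"
proof -
  have "(\<Oplus>\<^bsub>R\<^esub>i\<in>I. trace (s \<otimes>\<^bsub>R\<^esub> x i) \<otimes>\<^bsub>R\<^esub> y i)
      = (\<Oplus>\<^bsub>R\<^esub>i\<in>I. \<Oplus>\<^bsub>R\<^esub>g\<in>carrier G. gact g (s \<otimes>\<^bsub>R\<^esub> x i) \<otimes>\<^bsub>R\<^esub> y i)"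
    unfolding trace_def using s fin by (intro R.finsum_cong' refl R.finsum_ldistr) (auto intro!: R.finsum_closed)
  also have "\<dots> = (\<Oplus>\<^bsub>R\<^esub>g\<in>carrier G. \<Oplus>\<^bsub>R\<^esub>i\<in>I. gact g (s \<otimes>\<^bsub>R\<^esub> x i) \<otimes>\<^bsub>R\<^esub> y i)"
    using s fin fin_I by (intro R.finsum_swap) auto
  \<comment> \<open>Writing y_i as \<open>gact\<close> of the group unit brings the inner sum into
    the form of \<open>galois_conj\<close>.\<close>
  also have "\<dots> = (\<Oplus>\<^bsub>R\<^esub>g\<in>carrier G. gact g s \<otimes>\<^bsub>R\<^esub> (\<Oplus>\<^bsub>R\<^esub>i\<in>I. gact g (x i) \<otimes>\<^bsub>R\<^esub> gact \<one>\<^bsub>G\<^esub> (y i)))"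
    using s by (intro R.finsum_cong' refl, auto simp: R.finsum_rdistr fin_I gact_mult R.m_assoc Pi_def intro!: R.finsum_cong' R.finsum_closed)
  also have "\<dots> = (\<Oplus>\<^bsub>R\<^esub>g\<in>carrier G. if \<one>\<^bsub>G\<^esub> = g then gact g s else \<zero>\<^bsub>R\<^esub>)"
    using s by (intro R.finsum_cong' refl) (auto simp: galois_conj e_one)
  also have "\<dots> = s"
    using s fin by (subst R.finsum_singleton) auto
  finally show ?thesis .
qed

text \<open>Same exchange of sums; here the coefficient of b_g(s) is the left side of the Galois
  equation itself.\<close>

lemma trace_expansion_x:
  assumes s: "s \<in> carrier R"
  shows "(\<Oplus>\<^bsub>R\<^esub>i\<in>I. x i \<otimes>\<^bsub>R\<^esub> trace (y i \<otimes>\<^bsub>R\<^esub> s)) = s"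
proof -
  have "(\<Oplus>\<^bsub>R\<^esub>i\<in>I. x i \<otimes>\<^bsub>R\<^esub> trace (y i \<otimes>\<^bsub>R\<^esub> s))
      = (\<Oplus>\<^bsub>R\<^esub>i\<in>I. \<Oplus>\<^bsub>R\<^esub>g\<in>carrier G. x i \<otimes>\<^bsub>R\<^esub> gact g (y i \<otimes>\<^bsub>R\<^esub> s))"
    unfolding trace_def using s fin by (intro R.finsum_cong' refl R.finsum_rdistr) (auto intro!: R.finsum_closed)
  also have "\<dots> = (\<Oplus>\<^bsub>R\<^esub>g\<in>carrier G. \<Oplus>\<^bsub>R\<^esub>i\<in>I. x i \<otimes>\<^bsub>R\<^esub> gact g (y i \<otimes>\<^bsub>R\<^esub> s))"
    using s fin fin_I by (intro R.finsum_swap) auto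
  also have "\<dots> = (\<Oplus>\<^bsub>R\<^esub>g\<in>carrier G. (\<Oplus>\<^bsub>R\<^esub>i\<in>I. x i \<otimes>\<^bsub>R\<^esub> gact g (y i)) \<otimes>\<^bsub>R\<^esub> gact g s)"
    using s by (intro R.finsum_cong' refl, auto simp: R.finsum_ldistr fin_I gact_mult R.m_assoc Pi_def intro!: R.finsum_cong' R.finsum_closed)
  also have "\<dots> = (\<Oplus>\<^bsub>R\<^esub>g\<in>carrier G. if \<one>\<^bsub>G\<^esub> = g then gact g s else \<zero>\<^bsub>R\<^esub>)"
    using s by (intro R.finsum_cong' refl) (auto simp: galois)
  also have "\<dots> = s"
    using s fin by (subst R.finsum_singleton) auto
  finally show ?thesis .
qed

end

section \<open>The sets C_g inside A and their products\<close>

locale contained_galois = contained_partial_action G R e \<alpha> A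
  for G :: "('g, 'n) monoid_scheme" and R :: "('a, 'm) ring_scheme"
    and e :: "'g \<Rightarrow> 'a" and \<alpha> :: "'g \<Rightarrow> 'a \<Rightarrow> 'a" and A :: "('a, 'a) module" +
  fixes I :: "nat set" and x y :: "nat \<Rightarrow> 'a"
  assumes galois: "partial_galois G R e \<alpha> I x y"
    and alg: "k_algebra (invariants G R e \<alpha>) A"
    and ext: "contains_extension (invariants G R e \<alpha>) R A"
begin

sublocale P: partial_galois G R e \<alpha> I x y by (rule galois)
sublocale K: k_algebra "invariants G R e \<alpha>" A by (rule alg)

abbreviation (input) "k \<equiv> invariants G R e \<alpha>"
abbreviation "C \<equiv> cocycle_set G R e \<alpha> A"

lemmas xA [simp] = P.x_closed[THEN sub']
lemmas yA [simp] = P.y_closed[THEN sub']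
lemma gactA [simp]: "\<lbrakk>g \<in> carrier G; r \<in> carrier R\<rbrakk> \<Longrightarrow> U.gact g r \<in> carrier A"
  by (rule sub') simp

lemma Rone: "\<one>\<^bsub>R\<^esub> = \<one>\<^bsub>A\<^esub>" by (rule ring_hom_one[OF hom])

lemma Rzero: "\<zero>\<^bsub>R\<^esub> = \<zero>\<^bsub>A\<^esub>"
  using Radd[of "\<zero>\<^bsub>R\<^esub>" "\<zero>\<^bsub>R\<^esub>"] A.add.l_cancel_one[of "\<zero>\<^bsub>R\<^esub>" "\<zero>\<^bsub>R\<^esub>"] sub'[of "\<zero>\<^bsub>R\<^esub>"] by simp

lemma finsum_R: "f \<in> S \<rightarrow> carrier R \<Longrightarrow> finsum R f S = finsum A f S"
  using finsum_hom[of R A "\<lambda>r. r" f S] by (simp add: sub' Rzero Radd U.R.abelian_monoid_axioms A.abelian_monoid_axioms)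

lemma k_R: "t \<in> carrier k \<Longrightarrow> t \<in> carrier R"
  by (simp add: U.invariants_iff)

text \<open>Since A extends R, t acts on 1 as t itself; the two algebra laws at 1 then turn the
  scalar action into multiplication by t on either side. Hence invariants, and traces among them,
  are central in A.\<close>

lemma k_smult:
  assumes "t \<in> carrier k" "a \<in> carrier A"
  shows "t \<odot>\<^bsub>A\<^esub> a = t \<otimes>\<^bsub>A\<^esub> a" "t \<odot>\<^bsub>A\<^esub> a = a \<otimes>\<^bsub>A\<^esub> t"
proof -
  have "t \<odot>\<^bsub>A\<^esub> \<one>\<^bsub>A\<^esub> = t"
    using ext assms(1) k_R unfolding contains_extension_def by (metis Rone U.R.one_closed U.R.r_one)
  then show "t \<odot>\<^bsub>A\<^esub> a = t \<otimes>\<^bsub>A\<^esub> a" "t \<odot>\<^bsub>A\<^esub> a = a \<otimes>\<^bsub>A\<^esub> t"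
    using K.smult_mult_left[OF assms(1) A.one_closed assms(2)] K.smult_mult_right[OF assms(1) assms(2) A.one_closed] assms
    by simp_all
qed

text \<open>Membership in 1_{g^-1}A is the twist relation at r = 1, because b_{g^-1}(1) =
  1_{g^-1}.\<close>

lemma C_iff:
  assumes "g \<in> carrier G"
  shows "a \<in> C g \<longleftrightarrow> a \<in> carrier A \<and> (\<forall>r\<in>carrier R. U.gact (inv\<^bsub>G\<^esub> g) r \<otimes>\<^bsub>A\<^esub> a = a \<otimes>\<^bsub>A\<^esub> r)"
proof -
  interpret at: contained_partial_action_at G R e \<alpha> A g by unfold_locales (rule assms)
  have "e (inv\<^bsub>G\<^esub> g) \<otimes>\<^bsub>A\<^esub> a = a" if "a \<in> carrier A" "\<forall>r\<in>carrier R. U.gact (inv\<^bsub>G\<^esub> g) r \<otimes>\<^bsub>A\<^esub> a = a \<otimes>\<^bsub>A\<^esub> r"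
    using that(1) bspec[OF that(2) U.R.one_closed] assms by (simp add: U.gact_ring_one) (simp add: Rone)
  then show ?thesis
    using assms at.C_I[of a] at.C_A at.C_tw by (auto simp: U.gact_def)
qed

lemma C_closed: "\<lbrakk>g \<in> carrier G; a \<in> C g\<rbrakk> \<Longrightarrow> a \<in> carrier A"
  by (simp add: C_iff)

lemma C_twist: "\<lbrakk>g \<in> carrier G; a \<in> C g; r \<in> carrier R\<rbrakk> \<Longrightarrow> U.gact (inv\<^bsub>G\<^esub> g) r \<otimes>\<^bsub>A\<^esub> a = a \<otimes>\<^bsub>A\<^esub> r"
  by (simp add: C_iff)

lemma C_e:
  assumes "g \<in> carrier G" "a \<in> C g"
  shows "e (inv\<^bsub>G\<^esub> g) \<otimes>\<^bsub>A\<^esub> a = a"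
  using C_twist[OF assms U.R.one_closed] C_closed[OF assms] assms(1)
  by (simp add: U.gact_ring_one) (simp add: Rone)

lemma C_one: "\<one>\<^bsub>A\<^esub> \<in> C \<one>\<^bsub>G\<^esub>"
  by (simp add: C_iff sub')

text \<open>Moving r leftwards past u and then v applies b_{g^-1} first and b_{h^-1} second, and
  h^-1g^-1 = (gh)^-1. This is why the grading fits the reversed product vu and the opposite of A
  appears. The leftover 1_{h^-1} is absorbed by v.\<close>

lemma C_mult:
  assumes g: "g \<in> carrier G" and h: "h \<in> carrier G" and u: "u \<in> C g" and v: "v \<in> C h"
  shows "v \<otimes>\<^bsub>A\<^esub> u \<in> C (g \<otimes>\<^bsub>G\<^esub> h)"
proof -
  have uv: "u \<in> carrier A" "v \<in> carrier A" using assms C_closed by auto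
  have ih: "e (inv\<^bsub>G\<^esub> h) \<in> carrier R" using h by (simp add: U.idem_closed)
  have ev: "e (inv\<^bsub>G\<^esub> h) \<otimes>\<^bsub>A\<^esub> v = v"
    by (rule C_e[OF h v])
  have "U.gact (inv\<^bsub>G\<^esub> (g \<otimes>\<^bsub>G\<^esub> h)) r \<otimes>\<^bsub>A\<^esub> (v \<otimes>\<^bsub>A\<^esub> u) = v \<otimes>\<^bsub>A\<^esub> u \<otimes>\<^bsub>A\<^esub> r" if r: "r \<in> carrier R" for r
  proof -
    have gr: "U.gact (inv\<^bsub>G\<^esub> (g \<otimes>\<^bsub>G\<^esub> h)) r \<in> carrier R" using g h r by simp
    have "v \<otimes>\<^bsub>A\<^esub> u \<otimes>\<^bsub>A\<^esub> r = v \<otimes>\<^bsub>A\<^esub> (U.gact (inv\<^bsub>G\<^esub> g) r \<otimes>\<^bsub>A\<^esub> u)"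
      using C_twist[OF g u r] uv r by (simp add: A.m_assoc sub')
    also have "\<dots> = U.gact (inv\<^bsub>G\<^esub> h) (U.gact (inv\<^bsub>G\<^esub> g) r) \<otimes>\<^bsub>A\<^esub> v \<otimes>\<^bsub>A\<^esub> u"
      using C_twist[OF h v, of "U.gact (inv\<^bsub>G\<^esub> g) r"] uv r g by (simp add: A.m_assoc)
    also have "U.gact (inv\<^bsub>G\<^esub> h) (U.gact (inv\<^bsub>G\<^esub> g) r) = U.gact (inv\<^bsub>G\<^esub> (g \<otimes>\<^bsub>G\<^esub> h)) r \<otimes>\<^bsub>A\<^esub> e (inv\<^bsub>G\<^esub> h)"
      using g h r gr ih by (simp add: U.gact_gact U.G.inv_mult_group Rmult)
    finally show ?thesis using ev uv gr ih by (simp add: A.m_assoc sub')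
  qed
  then show ?thesis using uv g h by (simp add: C_iff)
qed

section \<open>The projections of A onto the C_g\<close>

definition proj :: "'g \<Rightarrow> 'a \<Rightarrow> 'a"
  where "proj g a = (\<Oplus>\<^bsub>A\<^esub>i\<in>I. U.gact (inv\<^bsub>G\<^esub> g) (x i) \<otimes>\<^bsub>A\<^esub> a \<otimes>\<^bsub>A\<^esub> y i)"

lemma proj_closed: "\<lbrakk>g \<in> carrier G; a \<in> carrier A\<rbrakk> \<Longrightarrow> proj g a \<in> carrier A"
  unfolding proj_def by (rule A.finsum_closed) simp

lemma proj_C:
  assumes g: "g \<in> carrier G" and a: "a \<in> carrier A"
  shows "proj g a \<in> C g"
proof -
  let ?g = "inv\<^bsub>G\<^esub> g"
  have "U.gact ?g r \<otimes>\<^bsub>A\<^esub> proj g a = proj g a \<otimes>\<^bsub>A\<^esub> r" if r: "r \<in> carrier R" for r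
  proof -
    \<comment> \<open>One matrix of invariants describes multiplication by r on both sides: r x_j =
      Sum_i x_i t_ij and y_i r = Sum_j t_ij y_j. Thus r enters at the x's as a matrix and leaves at
      the y's as the same matrix.\<close>
    define t where "t i j = U.trace (y i \<otimes>\<^bsub>R\<^esub> (r \<otimes>\<^bsub>R\<^esub> x j))" for i j
    have tk: "t i j \<in> carrier k" if "i \<in> I" "j \<in> I" for i j
      unfolding t_def using that r by (intro U.trace_invariant P.fin) simp
    note tR = k_R[OF tk] and tA = k_R[OF tk, THEN sub']
    have L: "U.gact ?g (r \<otimes>\<^bsub>R\<^esub> x j) = (\<Oplus>\<^bsub>A\<^esub>i\<in>I. U.gact ?g (x i) \<otimes>\<^bsub>A\<^esub> t i j)" if j: "j \<in> I" for j
    proof -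
      have "U.gact ?g (r \<otimes>\<^bsub>R\<^esub> x j) = U.gact ?g (\<Oplus>\<^bsub>R\<^esub>i\<in>I. x i \<otimes>\<^bsub>R\<^esub> t i j)"
        using P.trace_expansion_x[of "r \<otimes>\<^bsub>R\<^esub> x j"] r j by (simp add: t_def)
      \<comment> \<open>The coefficients t_ij are invariant, so b_{g^-1} leaves them
        untouched.\<close>
      also have "\<dots> = (\<Oplus>\<^bsub>R\<^esub>i\<in>I. U.gact ?g (x i) \<otimes>\<^bsub>R\<^esub> t i j)"
        using g j tk tR by (subst U.gact_finsum) (auto simp: U.gact_invariant_mult intro!: U.R.finsum_cong')
      also have "\<dots> = (\<Oplus>\<^bsub>A\<^esub>i\<in>I. U.gact ?g (x i) \<otimes>\<^bsub>A\<^esub> t i j)"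
        using g j tR tA by (subst finsum_R) (auto simp: Rmult intro!: A.finsum_cong')
      finally show ?thesis .
    qed
    have Y: "y i \<otimes>\<^bsub>A\<^esub> r = (\<Oplus>\<^bsub>A\<^esub>j\<in>I. t i j \<otimes>\<^bsub>A\<^esub> y j)" if i: "i \<in> I" for i
    proof -
      have "y i \<otimes>\<^bsub>R\<^esub> r = (\<Oplus>\<^bsub>R\<^esub>j\<in>I. t i j \<otimes>\<^bsub>R\<^esub> y j)"
      proof -
        \<comment> \<open>Rebracketing y_i(r x_j) as (y_i r)x_j makes the same entries the
          coefficients of the expansion of y_i r.\<close>
        have "(\<Oplus>\<^bsub>R\<^esub>j\<in>I. t i j \<otimes>\<^bsub>R\<^esub> y j) = (\<Oplus>\<^bsub>R\<^esub>j\<in>I. U.trace (y i \<otimes>\<^bsub>R\<^esub> r \<otimes>\<^bsub>R\<^esub> x j) \<otimes>\<^bsub>R\<^esub> y j)"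
          using r i by (intro U.R.finsum_cong' refl) (auto simp: t_def U.R.m_assoc)
        then show ?thesis using P.trace_expansion_y[of "y i \<otimes>\<^bsub>R\<^esub> r"] r i by simp
      qed
      also have "\<dots> = (\<Oplus>\<^bsub>A\<^esub>j\<in>I. t i j \<otimes>\<^bsub>A\<^esub> y j)"
        using i tR tA by (subst finsum_R) (auto simp: Rmult intro!: A.finsum_cong')
      finally show ?thesis using i r by (simp add: Rmult)
    qed
    have rx: "U.gact ?g (r \<otimes>\<^bsub>R\<^esub> x j) = U.gact ?g r \<otimes>\<^bsub>A\<^esub> U.gact ?g (x j)" if "j \<in> I" for j
      using that g r by (subst U.gact_mult) (simp_all add: Rmult)
    have "U.gact ?g r \<otimes>\<^bsub>A\<^esub> proj g a = (\<Oplus>\<^bsub>A\<^esub>j\<in>I. U.gact ?g (r \<otimes>\<^bsub>R\<^esub> x j) \<otimes>\<^bsub>A\<^esub> a \<otimes>\<^bsub>A\<^esub> y j)"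
      unfolding proj_def using g r a
      by (subst A.finsum_rdistr) (auto simp: P.fin_I rx A.m_assoc intro!: A.finsum_cong')
    also have "\<dots> = (\<Oplus>\<^bsub>A\<^esub>j\<in>I. \<Oplus>\<^bsub>A\<^esub>i\<in>I. U.gact ?g (x i) \<otimes>\<^bsub>A\<^esub> t i j \<otimes>\<^bsub>A\<^esub> a \<otimes>\<^bsub>A\<^esub> y j)"
      using g a tA by (intro A.finsum_cong' refl) (auto simp: L A.finsum_ldistr P.fin_I Pi_def intro!: A.finsum_closed)
    also have "\<dots> = (\<Oplus>\<^bsub>A\<^esub>i\<in>I. \<Oplus>\<^bsub>A\<^esub>j\<in>I. U.gact ?g (x i) \<otimes>\<^bsub>A\<^esub> t i j \<otimes>\<^bsub>A\<^esub> a \<otimes>\<^bsub>A\<^esub> y j)"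
      using g a tA P.fin_I by (intro A.finsum_swap) auto
    also have "\<dots> = (\<Oplus>\<^bsub>A\<^esub>i\<in>I. \<Oplus>\<^bsub>A\<^esub>j\<in>I. U.gact ?g (x i) \<otimes>\<^bsub>A\<^esub> a \<otimes>\<^bsub>A\<^esub> (t i j \<otimes>\<^bsub>A\<^esub> y j))"
    proof (intro A.finsum_cong' refl)
      fix i j assume ij: "i \<in> I" "j \<in> I"
      have "t i j \<otimes>\<^bsub>A\<^esub> a = a \<otimes>\<^bsub>A\<^esub> t i j"
        using k_smult[OF tk[OF ij] a] by simp
      then have "U.gact ?g (x i) \<otimes>\<^bsub>A\<^esub> (t i j \<otimes>\<^bsub>A\<^esub> a) \<otimes>\<^bsub>A\<^esub> y j = U.gact ?g (x i) \<otimes>\<^bsub>A\<^esub> (a \<otimes>\<^bsub>A\<^esub> t i j) \<otimes>\<^bsub>A\<^esub> y j"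
        by simp
      then show "U.gact ?g (x i) \<otimes>\<^bsub>A\<^esub> t i j \<otimes>\<^bsub>A\<^esub> a \<otimes>\<^bsub>A\<^esub> y j = U.gact ?g (x i) \<otimes>\<^bsub>A\<^esub> a \<otimes>\<^bsub>A\<^esub> (t i j \<otimes>\<^bsub>A\<^esub> y j)"
        using g a tA[OF ij] ij by (simp add: A.m_assoc)
    qed (use g a tA in \<open>auto intro!: A.finsum_closed\<close>)
    also have "\<dots> = (\<Oplus>\<^bsub>A\<^esub>i\<in>I. U.gact ?g (x i) \<otimes>\<^bsub>A\<^esub> a \<otimes>\<^bsub>A\<^esub> (y i \<otimes>\<^bsub>A\<^esub> r))"
      using g a tA r by (intro A.finsum_cong' refl) (auto simp: Y A.finsum_rdistr P.fin_I Pi_def intro!: A.finsum_closed)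
    also have "\<dots> = proj g a \<otimes>\<^bsub>A\<^esub> r"
      unfolding proj_def using g r a
      by (subst A.finsum_ldistr) (auto simp: P.fin_I A.m_assoc sub' intro!: A.finsum_cong')
    finally show ?thesis .
  qed
  then show ?thesis using proj_closed[OF g a] g by (simp add: C_iff)
qed

lemma sum_proj:
  assumes a: "a \<in> carrier A"
  shows "(\<Oplus>\<^bsub>A\<^esub>g\<in>carrier G. proj g a) = a"
proof -
  have tk: "U.trace (x i) \<in> carrier k" if "i \<in> I" for i
    using that by (intro U.trace_invariant P.fin) simp
  note tA = k_R[OF tk, THEN sub']
  have im: "(\<lambda>g. inv\<^bsub>G\<^esub> g) ` carrier G = carrier G"
    by (metis U.G.inv_closed U.G.inv_inv image_eqI subsetI subset_antisym imageE)
  \<comment> \<open>Since \<open>proj g\<close> involves b_{g^-1}, summing over g gives a trace only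
    after reindexing by inversion.\<close>
  have tr: "(\<Oplus>\<^bsub>A\<^esub>g\<in>carrier G. U.gact (inv\<^bsub>G\<^esub> g) (x i)) = U.trace (x i)" if i: "i \<in> I" for i
  proof -
    have "U.trace (x i) = (\<Oplus>\<^bsub>A\<^esub>g\<in>(\<lambda>g. inv\<^bsub>G\<^esub> g) ` carrier G. U.gact g (x i))"
      unfolding U.trace_def im using i by (intro finsum_R) auto
    also have "\<dots> = (\<Oplus>\<^bsub>A\<^esub>g\<in>carrier G. U.gact (inv\<^bsub>G\<^esub> g) (x i))"
      using i by (intro A.finsum_reindex) (auto simp: U.G.inv_inj)
    finally show ?thesis by simp
  qed
  have "(\<Oplus>\<^bsub>A\<^esub>g\<in>carrier G. proj g a)
      = (\<Oplus>\<^bsub>A\<^esub>i\<in>I. \<Oplus>\<^bsub>A\<^esub>g\<in>carrier G. U.gact (inv\<^bsub>G\<^esub> g) (x i) \<otimes>\<^bsub>A\<^esub> a \<otimes>\<^bsub>A\<^esub> y i)"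
    unfolding proj_def using a P.fin P.fin_I by (intro A.finsum_swap) auto
  also have "\<dots> = (\<Oplus>\<^bsub>A\<^esub>i\<in>I. U.trace (x i) \<otimes>\<^bsub>A\<^esub> a \<otimes>\<^bsub>A\<^esub> y i)"
    using a P.fin tA by (intro A.finsum_cong' refl) (auto simp: tr[symmetric] A.finsum_ldistr P.fin_I Pi_def intro!: A.finsum_closed)
  also have "\<dots> = (\<Oplus>\<^bsub>A\<^esub>i\<in>I. a \<otimes>\<^bsub>A\<^esub> (U.trace (x i) \<otimes>\<^bsub>A\<^esub> y i))"
    using a tA by (intro A.finsum_cong' refl) (auto simp: k_smult(1)[OF tk a, symmetric] k_smult(2)[OF tk a] A.m_assoc)
  also have "\<dots> = a \<otimes>\<^bsub>A\<^esub> (\<Oplus>\<^bsub>A\<^esub>i\<in>I. U.trace (x i) \<otimes>\<^bsub>A\<^esub> y i)"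
    using a tA P.fin_I by (intro A.finsum_rdistr[symmetric]) auto
  also have "(\<Oplus>\<^bsub>A\<^esub>i\<in>I. U.trace (x i) \<otimes>\<^bsub>A\<^esub> y i) = (\<Oplus>\<^bsub>R\<^esub>i\<in>I. U.trace (\<one>\<^bsub>R\<^esub> \<otimes>\<^bsub>R\<^esub> x i) \<otimes>\<^bsub>R\<^esub> y i)"
  proof -
    have "U.trace (\<one>\<^bsub>R\<^esub> \<otimes>\<^bsub>R\<^esub> x i) \<otimes>\<^bsub>R\<^esub> y i = U.trace (x i) \<otimes>\<^bsub>A\<^esub> y i" if "i \<in> I" for i
      unfolding U.R.l_one[OF P.x_closed[OF that]] using that by (simp add: Rmult)
    then show ?thesis using tA by (subst finsum_R) (auto intro!: A.finsum_cong')
  qed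
  also have "\<dots> = \<one>\<^bsub>A\<^esub>"
    unfolding P.trace_expansion_y[OF U.R.one_closed] by (rule Rone)
  finally show ?thesis using a by simp
qed

text \<open>The twist relation carries y_i to the left of a as b_{g^-1}(y_i), which leaves a sum
  evaluated by \<open>galois_conj\<close> at h^-1 and g^-1. Its diagonal value 1_{g^-1} is a left
  unit on C_g.\<close>

lemma proj_on_C:
  assumes g: "g \<in> carrier G" and h: "h \<in> carrier G" and a: "a \<in> C g"
  shows "proj h a = (if h = g then a else \<zero>\<^bsub>A\<^esub>)"
proof -
  have aA: "a \<in> carrier A" using C_closed[OF g a] .
  have ea: "e (inv\<^bsub>G\<^esub> g) \<otimes>\<^bsub>A\<^esub> a = a"
    by (rule C_e[OF g a])
  have "proj h a = (\<Oplus>\<^bsub>A\<^esub>i\<in>I. (U.gact (inv\<^bsub>G\<^esub> h) (x i) \<otimes>\<^bsub>A\<^esub> U.gact (inv\<^bsub>G\<^esub> g) (y i)) \<otimes>\<^bsub>A\<^esub> a)"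
    unfolding proj_def using g h aA C_twist[OF g a, symmetric]
    by (intro A.finsum_cong' refl) (auto simp: A.m_assoc)
  also have "\<dots> = (\<Oplus>\<^bsub>A\<^esub>i\<in>I. U.gact (inv\<^bsub>G\<^esub> h) (x i) \<otimes>\<^bsub>R\<^esub> U.gact (inv\<^bsub>G\<^esub> g) (y i)) \<otimes>\<^bsub>A\<^esub> a"
    using g h aA by (subst A.finsum_ldistr) (auto simp: P.fin_I Rmult intro!: A.finsum_cong')
  also have "(\<Oplus>\<^bsub>A\<^esub>i\<in>I. U.gact (inv\<^bsub>G\<^esub> h) (x i) \<otimes>\<^bsub>R\<^esub> U.gact (inv\<^bsub>G\<^esub> g) (y i))
      = (if inv\<^bsub>G\<^esub> h = inv\<^bsub>G\<^esub> g then e (inv\<^bsub>G\<^esub> h) else \<zero>\<^bsub>A\<^esub>)"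
    using P.galois_conj[of "inv\<^bsub>G\<^esub> h" "inv\<^bsub>G\<^esub> g"] g h by (subst finsum_R[symmetric]) (auto simp: Rzero)
  finally show ?thesis using ea aA g h by (auto dest: inj_onD[OF U.G.inv_inj])
qed

section \<open>The bimodules Gamma_g and the values of the factor set\<close>

text \<open>R is commutative and hence lies in C_1, so both scalings are products covered by
  \<open>C_mult\<close>.\<close>

lemma C_scale:
  assumes g: "g \<in> carrier G" and a: "a \<in> C g" and r: "r \<in> carrier R"
  shows "a \<otimes>\<^bsub>A\<^esub> r \<in> C g" "r \<otimes>\<^bsub>A\<^esub> a \<in> C g"
proof -
  have "r \<in> C \<one>\<^bsub>G\<^esub>" using r by (simp add: C_iff sub' Rmult[symmetric] U.R.m_comm)
  then show "a \<otimes>\<^bsub>A\<^esub> r \<in> C g" "r \<otimes>\<^bsub>A\<^esub> a \<in> C g"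
    using C_mult[of "\<one>\<^bsub>G\<^esub>" g r a] C_mult[of g "\<one>\<^bsub>G\<^esub>" a r] g a by simp_all
qed

lemma Gamma_sel [simp]:
  "carrier (Gamma_bimodule G R e \<alpha> A g) = C g" "\<zero>\<^bsub>Gamma_bimodule G R e \<alpha> A g\<^esub> = \<zero>\<^bsub>A\<^esub>"
  "add (Gamma_bimodule G R e \<alpha> A g) = add A" "r \<odot>\<^bsub>Gamma_bimodule G R e \<alpha> A g\<^esub> a = a \<otimes>\<^bsub>A\<^esub> r"
  "rsmult (Gamma_bimodule G R e \<alpha> A g) a r = r \<otimes>\<^bsub>A\<^esub> a"
  by (simp_all add: Gamma_bimodule_def)

lemma Gamma_abelian: "g \<in> carrier G \<Longrightarrow> abelian_group (Gamma_bimodule G R e \<alpha> A g)"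
  by (rule contained_partial_action_at.GB_ab) unfold_locales

lemma Gamma_group: "g \<in> carrier G \<Longrightarrow> group (add_monoid (Gamma_bimodule G R e \<alpha> A g))"
  using Gamma_abelian abelian_group.a_group by blast

lemma C_add: "\<lbrakk>g \<in> carrier G; a \<in> C g; b \<in> C g\<rbrakk> \<Longrightarrow> a \<oplus>\<^bsub>A\<^esub> b \<in> C g"
  using abelian_monoid.a_closed[OF abelian_group.axioms(1)[OF Gamma_abelian], of g a b] by simp

lemma C_zero: "g \<in> carrier G \<Longrightarrow> \<zero>\<^bsub>A\<^esub> \<in> C g"
  using abelian_monoid.zero_closed[OF abelian_group.axioms(1)[OF Gamma_abelian], of g] by simp

lemma finsum_Gamma:
  assumes "g \<in> carrier G" "f \<in> S \<rightarrow> C g"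
  shows "finsum (Gamma_bimodule G R e \<alpha> A g) f S = finsum A f S" "finsum A f S \<in> C g"
proof -
  have ab: "abelian_monoid (Gamma_bimodule G R e \<alpha> A g)"
    using Gamma_abelian[OF assms(1)] abelian_group.axioms(1) by blast
  show "finsum (Gamma_bimodule G R e \<alpha> A g) f S = finsum A f S"
    using finsum_hom[OF ab A.abelian_monoid_axioms, of "\<lambda>a. a" f S] assms C_closed by auto
  then show "finsum A f S \<in> C g"
    using abelian_monoid.finsum_closed[OF ab, of f S] assms(2) by simp
qed

text \<open>\<open>tensor_lift\<close> has a determined value on a class because the map is
  balanced: the actions of Gamma_g swap sides, so the condition reads v(ru) = (vr)u, which is
  associativity in A.\<close>

lemma factor_set_pure_tensor:
  assumes g: "g \<in> carrier G" and h: "h \<in> carrier G" and u: "u \<in> C g" and v: "v \<in> C h"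
  shows "Gamma_factor_set G R e \<alpha> A g h
    (pure_tensor R (Gamma_bimodule G R e \<alpha> A g) (Gamma_bimodule G R e \<alpha> A h) u v) = v \<otimes>\<^bsub>A\<^esub> u"
proof -
  interpret T: tensor_pair R "Gamma_bimodule G R e \<alpha> A g" "Gamma_bimodule G R e \<alpha> A h"
    using g h by (intro tensor_pair.intro Gamma_abelian) (simp_all add: C_scale)
  have gh: "g \<otimes>\<^bsub>G\<^esub> h \<in> carrier G" using g h by simp
  have "Gamma_factor_set G R e \<alpha> A g h (T.cl (frag_of (u, v)))
      = frag_eval (Gamma_bimodule G R e \<alpha> A (g \<otimes>\<^bsub>G\<^esub> h)) (\<lambda>(u, v). v \<otimes>\<^bsub>A\<^esub> u) (frag_of (u, v))"
    unfolding Gamma_factor_set_def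
    by (rule T.tensor_lift_class[OF Gamma_abelian[OF gh]])
      (use g h u v C_mult[OF g h] C_closed[OF g] C_closed[OF h] in
        \<open>simp_all add: A.l_distr A.r_distr A.m_assoc sub'\<close>)
  also have "\<dots> = v \<otimes>\<^bsub>A\<^esub> u"
    using C_mult[OF g h u v] by (subst frag_eval_of[OF Gamma_abelian[OF gh]]) simp_all
  finally show ?thesis by (simp add: pure_tensor_def)
qed

section \<open>The crossed product as families of elements of A\<close>

abbreviation (input) "\<Delta> \<equiv> Delta_Gamma G R e \<alpha> A"

text \<open>\<open>sum_group\<close> demands finite support, which is automatic for finite
  G.\<close>

lemma Delta_carrier: "carrier \<Delta> = (\<Pi>\<^sub>E g\<in>carrier G. C g)"
proof -
  have "carrier \<Delta> = carrier (sum_group (carrier G) (\<lambda>g. add_monoid (Gamma_bimodule G R e \<alpha> A g)))"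
    by (simp only: Delta_Gamma_def partial_crossed_product_def Let_def partial_object.simps)
  then show ?thesis using P.fin by (simp only: carrier_sum_group[OF Gamma_group]) simp
qed

lemma Delta_simps:
  "\<one>\<^bsub>\<Delta>\<^esub> = (\<lambda>k\<in>carrier G. if k = \<one>\<^bsub>G\<^esub> then \<one>\<^bsub>A\<^esub> else \<zero>\<^bsub>A\<^esub>)" "\<zero>\<^bsub>\<Delta>\<^esub> = (\<lambda>k\<in>carrier G. \<zero>\<^bsub>A\<^esub>)"
  "u \<oplus>\<^bsub>\<Delta>\<^esub> v = (\<lambda>k\<in>carrier G. u k \<oplus>\<^bsub>A\<^esub> v k)" "r \<odot>\<^bsub>\<Delta>\<^esub> u = (\<lambda>k\<in>carrier G. u k \<otimes>\<^bsub>A\<^esub> r)"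
  by (auto simp: Delta_Gamma_def partial_crossed_product_def Let_def fun_eq_iff)

text \<open>The pairs (g, h) with gh = k are the (g, g^-1k), which turns the sum over pairs into a
  convolution over G, computed in A.\<close>

lemma Delta_mult:
  assumes u: "u \<in> carrier \<Delta>" and v: "v \<in> carrier \<Delta>"
  shows "u \<otimes>\<^bsub>\<Delta>\<^esub> v = (\<lambda>k\<in>carrier G. \<Oplus>\<^bsub>A\<^esub>g\<in>carrier G. v (inv\<^bsub>G\<^esub> g \<otimes>\<^bsub>G\<^esub> k) \<otimes>\<^bsub>A\<^esub> u g)"
    and "u \<otimes>\<^bsub>\<Delta>\<^esub> v \<in> carrier \<Delta>"
proof -
  have uC: "\<And>g. g \<in> carrier G \<Longrightarrow> u g \<in> C g" and vC: "\<And>g. g \<in> carrier G \<Longrightarrow> v g \<in> C g"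
    using u v by (auto simp: Delta_carrier)
  note uvC = C_mult[OF _ _ uC vC]
  let ?p = "\<lambda>k g. (g, inv\<^bsub>G\<^esub> g \<otimes>\<^bsub>G\<^esub> k)" and ?F = "\<lambda>k. {(g, h). g \<in> carrier G \<and> h \<in> carrier G \<and> g \<otimes>\<^bsub>G\<^esub> h = k}"
  let ?f = "\<lambda>(g, h). Gamma_factor_set G R e \<alpha> A g h
    (pure_tensor R (Gamma_bimodule G R e \<alpha> A g) (Gamma_bimodule G R e \<alpha> A h) (u g) (v h))"
  have "finsum (Gamma_bimodule G R e \<alpha> A k) ?f (?F k) = (\<Oplus>\<^bsub>A\<^esub>g\<in>carrier G. v (inv\<^bsub>G\<^esub> g \<otimes>\<^bsub>G\<^esub> k) \<otimes>\<^bsub>A\<^esub> u g) \<and>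
      (\<Oplus>\<^bsub>A\<^esub>g\<in>carrier G. v (inv\<^bsub>G\<^esub> g \<otimes>\<^bsub>G\<^esub> k) \<otimes>\<^bsub>A\<^esub> u g) \<in> C k" if k: "k \<in> carrier G" for k
  proof -
    have F: "?F k = ?p k ` carrier G"
      using k by (force simp: U.G.m_assoc[symmetric] image_iff)
    have "?f \<in> ?F k \<rightarrow> C k"
      using uvC by (auto simp: factor_set_pure_tensor uC vC)
    then have "finsum (Gamma_bimodule G R e \<alpha> A k) ?f (?F k) = finsum A ?f (?p k ` carrier G)"
      unfolding F[symmetric] by (rule finsum_Gamma(1)[OF k])
    also have "\<dots> = (\<Oplus>\<^bsub>A\<^esub>g\<in>carrier G. ?f (?p k g))"
      using k C_closed[OF _ uC] C_closed[OF _ vC]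
      by (intro A.finsum_reindex) (auto simp: factor_set_pure_tensor uC vC intro!: inj_onI)
    also have "\<dots> = (\<Oplus>\<^bsub>A\<^esub>g\<in>carrier G. v (inv\<^bsub>G\<^esub> g \<otimes>\<^bsub>G\<^esub> k) \<otimes>\<^bsub>A\<^esub> u g)"
      using k C_closed[OF _ uC] C_closed[OF _ vC]
      by (intro A.finsum_cong' refl) (auto simp: factor_set_pure_tensor uC vC)
    finally have eq: "finsum (Gamma_bimodule G R e \<alpha> A k) ?f (?F k) = (\<Oplus>\<^bsub>A\<^esub>g\<in>carrier G. v (inv\<^bsub>G\<^esub> g \<otimes>\<^bsub>G\<^esub> k) \<otimes>\<^bsub>A\<^esub> u g)" .
    have "v (inv\<^bsub>G\<^esub> g \<otimes>\<^bsub>G\<^esub> k) \<otimes>\<^bsub>A\<^esub> u g \<in> C k" if g: "g \<in> carrier G" for g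
      using uvC[of g "inv\<^bsub>G\<^esub> g \<otimes>\<^bsub>G\<^esub> k"] g k by (simp add: U.G.m_assoc[symmetric])
    then have "(\<lambda>g. v (inv\<^bsub>G\<^esub> g \<otimes>\<^bsub>G\<^esub> k) \<otimes>\<^bsub>A\<^esub> u g) \<in> carrier G \<rightarrow> C k" by blast
    then show ?thesis using eq finsum_Gamma(2)[OF k] by blast
  qed
  note * = this
  show eq: "u \<otimes>\<^bsub>\<Delta>\<^esub> v = (\<lambda>k\<in>carrier G. \<Oplus>\<^bsub>A\<^esub>g\<in>carrier G. v (inv\<^bsub>G\<^esub> g \<otimes>\<^bsub>G\<^esub> k) \<otimes>\<^bsub>A\<^esub> u g)"
    using * by (simp add: Delta_Gamma_def partial_crossed_product_def Let_def restrict_def fun_eq_iff)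
  show "u \<otimes>\<^bsub>\<Delta>\<^esub> v \<in> carrier \<Delta>"
    unfolding eq Delta_carrier using * by auto
qed

section \<open>The summing map from the crossed product to A\<close>

definition total :: "('g \<Rightarrow> 'a) \<Rightarrow> 'a"
  where "total u = (\<Oplus>\<^bsub>A\<^esub>g\<in>carrier G. u g)"

lemma Delta_A: "\<lbrakk>u \<in> carrier \<Delta>; g \<in> carrier G\<rbrakk> \<Longrightarrow> u g \<in> carrier A"
  by (rule C_closed) (auto simp: Delta_carrier)

lemma total_bij: "bij_betw total (carrier \<Delta>) (carrier A)"
proof (rule bij_betw_byWitness[where f' = "\<lambda>a. \<lambda>g\<in>carrier G. proj g a"])
  show "\<forall>u\<in>carrier \<Delta>. (\<lambda>g\<in>carrier G. proj g (total u)) = u"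
  proof
    fix u assume u: "u \<in> carrier \<Delta>"
    have "proj h (total u) = u h" if h: "h \<in> carrier G" for h
    proof -
      have "proj h (total u) = (\<Oplus>\<^bsub>A\<^esub>g\<in>carrier G. proj h (u g))"
        unfolding total_def
      proof (rule finsum_hom[OF A.abelian_monoid_axioms A.abelian_monoid_axioms])
        show "proj h \<zero>\<^bsub>A\<^esub> = \<zero>\<^bsub>A\<^esub>"
          using proj_on_C[OF h h C_zero[OF h]] by simp
        fix a b assume a: "a \<in> carrier A" and b: "b \<in> carrier A"
        show "proj h (a \<oplus>\<^bsub>A\<^esub> b) = proj h a \<oplus>\<^bsub>A\<^esub> proj h b"
          unfolding proj_def using a b h
          by (intro trans[OF A.finsum_cong' A.finsum_addf] refl) (auto simp: A.l_distr A.r_distr)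
      qed (use u h in \<open>auto simp: proj_closed Delta_A\<close>)
      also have "\<dots> = (\<Oplus>\<^bsub>A\<^esub>g\<in>carrier G. if h = g then u g else \<zero>\<^bsub>A\<^esub>)"
        using u h by (intro A.finsum_cong' refl) (auto simp: Delta_A proj_on_C Delta_carrier PiE_mem)
      also have "\<dots> = u h"
        using u h P.fin by (subst A.finsum_singleton) (auto simp: Delta_A)
      finally show ?thesis .
    qed
    \<comment> \<open>Outside \<open>carrier G\<close> both functions are \<open>undefined\<close>,
      since elements of the crossed product are extensional.\<close>
    then show "(\<lambda>g\<in>carrier G. proj g (total u)) = u"
      using u by (auto simp: Delta_carrier fun_eq_iff PiE_def extensional_def)
  qed
  show "\<forall>a\<in>carrier A. total (\<lambda>g\<in>carrier G. proj g a) = a"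
  proof
    fix a assume a: "a \<in> carrier A"
    have "total (\<lambda>g\<in>carrier G. proj g a) = (\<Oplus>\<^bsub>A\<^esub>g\<in>carrier G. proj g a)"
      unfolding total_def using a by (intro A.finsum_cong' refl) (auto simp: proj_closed)
    then show "total (\<lambda>g\<in>carrier G. proj g a) = a" using sum_proj[OF a] by simp
  qed
  show "total ` carrier \<Delta> \<subseteq> carrier A"
    by (auto simp: total_def Delta_A intro!: A.finsum_closed)
  show "(\<lambda>a. \<lambda>g\<in>carrier G. proj g a) ` carrier A \<subseteq> carrier \<Delta>"
    by (auto simp: Delta_carrier proj_C)
qed

text \<open>For fixed g the substitution h = g^-1k runs over all of G, so the double sum factors,
  with the v-sum on the left.\<close>

lemma total_mult:
  assumes u: "u \<in> carrier \<Delta>" and v: "v \<in> carrier \<Delta>"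
  shows "total (u \<otimes>\<^bsub>\<Delta>\<^esub> v) = total v \<otimes>\<^bsub>A\<^esub> total u"
proof -
  note [simp] = Delta_A[OF u] Delta_A[OF v]
  have "total (u \<otimes>\<^bsub>\<Delta>\<^esub> v) = (\<Oplus>\<^bsub>A\<^esub>k\<in>carrier G. \<Oplus>\<^bsub>A\<^esub>g\<in>carrier G. v (inv\<^bsub>G\<^esub> g \<otimes>\<^bsub>G\<^esub> k) \<otimes>\<^bsub>A\<^esub> u g)"
    unfolding total_def Delta_mult(1)[OF u v]
    by (intro A.finsum_cong' refl) (auto intro!: A.finsum_closed)
  also have "\<dots> = (\<Oplus>\<^bsub>A\<^esub>g\<in>carrier G. \<Oplus>\<^bsub>A\<^esub>k\<in>carrier G. v (inv\<^bsub>G\<^esub> g \<otimes>\<^bsub>G\<^esub> k) \<otimes>\<^bsub>A\<^esub> u g)"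
    using P.fin by (intro A.finsum_swap) auto
  also have "\<dots> = (\<Oplus>\<^bsub>A\<^esub>g\<in>carrier G. total v \<otimes>\<^bsub>A\<^esub> u g)"
  proof (intro A.finsum_cong' refl)
    fix g assume g: "g \<in> carrier G"
    then have ig: "inv\<^bsub>G\<^esub> g \<in> carrier G" by simp
    have "(\<Oplus>\<^bsub>A\<^esub>k\<in>carrier G. v (inv\<^bsub>G\<^esub> g \<otimes>\<^bsub>G\<^esub> k) \<otimes>\<^bsub>A\<^esub> u g)
        = (\<Oplus>\<^bsub>A\<^esub>h\<in>(\<lambda>k. inv\<^bsub>G\<^esub> g \<otimes>\<^bsub>G\<^esub> k) ` carrier G. v h \<otimes>\<^bsub>A\<^esub> u g)"
      using g ig by (intro A.finsum_reindex[symmetric]) (auto simp: U.G.inj_on_cmult)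
    also have "\<dots> = total v \<otimes>\<^bsub>A\<^esub> u g"
      unfolding U.G.surj_const_mult[OF ig] total_def
      using g P.fin by (intro A.finsum_ldistr[symmetric]) auto
    finally show "(\<Oplus>\<^bsub>A\<^esub>k\<in>carrier G. v (inv\<^bsub>G\<^esub> g \<otimes>\<^bsub>G\<^esub> k) \<otimes>\<^bsub>A\<^esub> u g) = total v \<otimes>\<^bsub>A\<^esub> u g" .
  qed (auto simp: total_def intro!: A.finsum_closed)
  also have "\<dots> = total v \<otimes>\<^bsub>A\<^esub> total u"
    unfolding total_def[of u] using P.fin
    by (intro A.finsum_rdistr[symmetric]) (auto simp: total_def intro!: A.finsum_closed)
  finally show ?thesis .
qed

lemma Delta_iso: "algebra_isomorphic k \<Delta> (opposite A)"
proof -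
  have add: "u \<oplus>\<^bsub>\<Delta>\<^esub> v \<in> carrier \<Delta> \<and> total (u \<oplus>\<^bsub>\<Delta>\<^esub> v) = total u \<oplus>\<^bsub>opposite A\<^esub> total v"
    if u: "u \<in> carrier \<Delta>" and v: "v \<in> carrier \<Delta>" for u v
  proof
    show "u \<oplus>\<^bsub>\<Delta>\<^esub> v \<in> carrier \<Delta>"
      using u v by (auto simp: Delta_simps Delta_carrier PiE_mem C_add)
    show "total (u \<oplus>\<^bsub>\<Delta>\<^esub> v) = total u \<oplus>\<^bsub>opposite A\<^esub> total v"
      unfolding total_def Delta_simps opposite_sel using u v
      by (intro trans[OF A.finsum_cong' A.finsum_addf] refl) (auto simp: Delta_A)
  qed
  have smult: "t \<odot>\<^bsub>\<Delta>\<^esub> u \<in> carrier \<Delta> \<and> total (t \<odot>\<^bsub>\<Delta>\<^esub> u) = t \<odot>\<^bsub>opposite A\<^esub> total u"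
    if t: "t \<in> carrier k" and u: "u \<in> carrier \<Delta>" for t u
  proof
    show "t \<odot>\<^bsub>\<Delta>\<^esub> u \<in> carrier \<Delta>"
      using u k_R[OF t] by (auto simp: Delta_simps Delta_carrier C_scale PiE_mem)
    have tu: "total u \<in> carrier A" using total_bij u by (auto simp: bij_betw_def)
    have tA: "t \<in> carrier A" using sub'[OF k_R[OF t]] .
    have "total (t \<odot>\<^bsub>\<Delta>\<^esub> u) = (\<Oplus>\<^bsub>A\<^esub>g\<in>carrier G. u g \<otimes>\<^bsub>A\<^esub> t)"
      unfolding total_def Delta_simps using u tA by (intro A.finsum_cong' refl) (auto simp: Delta_A)
    also have "\<dots> = total u \<otimes>\<^bsub>A\<^esub> t"
      unfolding total_def using u tA P.fin by (intro A.finsum_ldistr[symmetric]) (auto simp: Delta_A)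
    \<comment> \<open>Scalars act on the crossed product by right multiplication in A; centrality of
      t identifies this with the scalar action of A.\<close>
    finally show "total (t \<odot>\<^bsub>\<Delta>\<^esub> u) = t \<odot>\<^bsub>opposite A\<^esub> total u"
      using k_smult(2)[OF t tu] by simp
  qed
  have one: "\<one>\<^bsub>\<Delta>\<^esub> \<in> carrier \<Delta>" "total \<one>\<^bsub>\<Delta>\<^esub> = \<one>\<^bsub>opposite A\<^esub>"
  proof -
    show "\<one>\<^bsub>\<Delta>\<^esub> \<in> carrier \<Delta>" by (simp add: Delta_simps Delta_carrier C_one C_zero)
    have "total \<one>\<^bsub>\<Delta>\<^esub> = (\<Oplus>\<^bsub>A\<^esub>g\<in>carrier G. if \<one>\<^bsub>G\<^esub> = g then \<one>\<^bsub>A\<^esub> else \<zero>\<^bsub>A\<^esub>)"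
      unfolding total_def Delta_simps by (intro A.finsum_cong' refl) auto
    also have "\<dots> = \<one>\<^bsub>A\<^esub>" using P.fin by (subst A.finsum_singleton) auto
    finally show "total \<one>\<^bsub>\<Delta>\<^esub> = \<one>\<^bsub>opposite A\<^esub>" by simp
  qed
  have zero: "\<zero>\<^bsub>\<Delta>\<^esub> \<in> carrier \<Delta>" "total \<zero>\<^bsub>\<Delta>\<^esub> = \<zero>\<^bsub>opposite A\<^esub>"
  proof -
    show "\<zero>\<^bsub>\<Delta>\<^esub> \<in> carrier \<Delta>" by (simp add: Delta_simps Delta_carrier C_zero)
    have "total \<zero>\<^bsub>\<Delta>\<^esub> = (\<Oplus>\<^bsub>A\<^esub>g\<in>carrier G. \<zero>\<^bsub>A\<^esub>)"
      unfolding total_def Delta_simps by (intro A.finsum_cong' refl) auto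
    then show "total \<zero>\<^bsub>\<Delta>\<^esub> = \<zero>\<^bsub>opposite A\<^esub>" by (simp add: A.finsum_zero)
  qed
  have mult: "u \<otimes>\<^bsub>\<Delta>\<^esub> v \<in> carrier \<Delta> \<and> total (u \<otimes>\<^bsub>\<Delta>\<^esub> v) = total u \<otimes>\<^bsub>opposite A\<^esub> total v"
    if "u \<in> carrier \<Delta>" "v \<in> carrier \<Delta>" for u v
    using Delta_mult(2)[OF that] total_mult[OF that] by simp
  have bij: "bij_betw total (carrier \<Delta>) (carrier (opposite A))" using total_bij by simp
  have op: "k_algebra k (opposite A)" by (rule k_algebra_opposite[OF alg])
  have "k_algebra k \<Delta>"
    by (rule k_algebra_transport[OF op bij one zero add mult smult])
  moreover have "total \<in> ring_iso \<Delta> (opposite A)"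
    using add mult one bij by (intro ring_iso_memI) (auto simp: bij_betw_def)
  ultimately show ?thesis
    unfolding algebra_isomorphic_def using op smult by blast
qed

end

section \<open>The isomorphism, from a choice of Galois coordinates\<close>

theorem theorem3p23:
  fixes G :: "('g, 'n) monoid_scheme" and R :: "('a, 'm) ring_scheme"
    and e :: "'g \<Rightarrow> 'a" and \<alpha> :: "'g \<Rightarrow> 'a \<Rightarrow> 'a" and A :: "('a, 'a) module"
  assumes "unital_partial_action G R e \<alpha>" and "finite (carrier G)"
    and "partial_galois_extension G R e \<alpha>"
    and "azumaya_algebra (invariants G R e \<alpha>) A"
    and "contains_extension (invariants G R e \<alpha>) R A"
    and "maximal_commutative_subalgebra (invariants G R e \<alpha>) (carrier R) A"
  shows "algebra_isomorphic (invariants G R e \<alpha>) (Delta_Gamma G R e \<alpha> A) (opposite A)"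
proof -
  interpret unital_partial_action G R e \<alpha> by fact
  obtain m :: nat and x y where xy: "x \<in> {1..m} \<rightarrow> carrier R" "y \<in> {1..m} \<rightarrow> carrier R"
    and gal: "\<And>g. g \<in> carrier G \<Longrightarrow> (\<Oplus>\<^bsub>R\<^esub>i\<in>{1..m}. x i \<otimes>\<^bsub>R\<^esub> gact g (y i))
      = (if g = \<one>\<^bsub>G\<^esub> then \<one>\<^bsub>R\<^esub> else \<zero>\<^bsub>R\<^esub>)"
    using assms(3) unfolding partial_galois_extension_def gact_def by blast
  have "partial_galois G R e \<alpha> {1..m} x y"
    by unfold_locales (use xy gal assms(2) in auto)
  moreover have alg: "k_algebra (invariants G R e \<alpha>) A"
    using assms(4) by (simp add: azumaya_algebra_def separable_algebra_def)
  moreover have "contained_partial_action G R e \<alpha> A"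
    using assms(5) k_algebra.axioms(2)[OF alg] unital_partial_action_axioms
    by (simp add: contained_partial_action_def contains_extension_def)
  ultimately have "contained_galois G R e \<alpha> A {1..m} x y"
    using assms(5) by (intro contained_galois.intro contained_galois_axioms.intro)
  then show ?thesis by (rule contained_galois.Delta_iso)
qed

end
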